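(* Let $n\ge 1$ and let $\phi:\Omega^{m}_{\mathrm{uni}}(M_n(\mathbb C))\to\Omega^m(\mathbb{CP}^{n-1})$, $m\ge 0$, be the extension to forms of the state evaluation map described in the context: $\phi(E_{ab})=v_a\bar v_b$ in degree $0$ and, for $m\ge 2$, $\phi:\Omega^{m-1}_{\mathrm{uni}}(M_n(\mathbb C))\subset M_n(\mathbb C)^{\otimes m}\to \Omega^{m-1}(\mathbb{CP}^{n-1})$ is the restriction of the linear map $$E_{a_1b_1}\otimes\cdots\otimes E_{a_mb_m}\ \longmapsto\ \sum_{q_1,\dots,q_{m-1}} v_{a_1}\bar v_{q_1}\,\Gamma^{b_1q_1}{}_{a_2q_2}\wedge\Gamma^{b_2q_2}{}_{a_3q_3}\wedge\cdots\wedge\Gamma^{b_{m-1}q_{m-1}}{}_{a_mb_m}.$$ Then $\phi$ is a cochain map from the universal calculus on $M_n(\mathbb C)$ to the $\bar\partial$ calculus on $\mathbb{CP}^{n-1}$; that is, with $\pi^{0,m}:\Omega^m(\mathbb{CP}^{n-1})\to\Omega^{0,m}(\mathbb{CP}^{n-1})$ the projection, for all $m\ge 0$ and $\xi\in\Omega^m_{\mathrm{uni}}(M_n(\mathbb C))$, $$\bar\partial\big(\pi^{0,m}\phi(\xi)\big)=\pi^{0,m+1}\phi(\mathrm d\xi).$$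
   Context: Universal calculus: for a unital algebra $A$, $\Omega^m_{\mathrm{uni}}(A)\subset A^{\otimes (m+1)}$ is the intersection of the kernels of all multiplication maps of neighbouring factors, with $\Omega^0_{\mathrm{uni}}(A)=A$, product $(a_0\otimes\cdots\otimes a_k)\wedge(b_0\otimes\cdots\otimes b_l)=a_0\otimes\cdots\otimes a_kb_0\otimes\cdots\otimes b_l$, and differential $\mathrm da=1\otimes a-a\otimes 1$ on $A$, extended by $\mathrm d(a_0\otimes\cdots\otimes a_m)=\sum_{k=0}^{m+1}(-1)^k a_0\otimes\cdots\otimes a_{k-1}\otimes 1\otimes a_k\otimes\cdots\otimes a_m$. $E_{ij}\in M_n(\mathbb C)$ is the matrix with $1$ in row $i$, column $j$ and zero elsewhere. Projective space: $\mathbb{CP}^{n-1}$ is the quotient of the unit sphere $S^{2n-1}=\{\underline v=(v_1,\dots,v_n)\in\mathbb C^n:\sum|v_i|^2=1\}$ by $\underline v\sim z\underline v$, $|z|=1$, with its usual complex structure ($[v_1:\cdots:v_n]$ are homogeneous coordinates). Functions on $S^{2n-1}$ of grade zero ($v_i$ has grade $1$, $\bar v_i$ grade $-1$) are functions on $\mathbb{CP}^{n-1}$; put $Q_{ij}=v_i\bar v_j$. $\Omega^m(\mathbb{CP}^{n-1})=\bigoplus_{p+q=m}\Omega^{p,q}$ are the usual smooth complex forms, and $\bar\partial=\pi^{p,q+1}\mathrm d$ on $\Omega^{p,q}$. The symbols $\mathrm dv_i$ (type $(1,0)$) and $\mathrm d\bar v_i$ (type $(0,1)$) satisfy $\sum_i\bar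 v_i\,\mathrm dv_i=0$ and $\sum_iv_i\,\mathrm d\bar v_i=0$, and are only used in grade-zero combinations, which are honest forms on $\mathbb{CP}^{n-1}$: $v_q\mathrm d\bar v_s=\sum_kQ_{qk}\mathrm dQ_{ks}$ and $\bar v_p\mathrm dv_r=\sum_k(\mathrm dQ_{rk})Q_{kp}$. The one-forms used are $$\Gamma^{pq}{}_{rs}=v_q\big(\delta_{pr}\,\mathrm d\bar v_s-\bar v_s v_r\,\mathrm d\bar v_p+\bar v_s\bar v_p\,\mathrm dv_r\big)\in\Omega^1(\mathbb{CP}^{n-1}).$$ The state evaluation map is $\phi(a)([\underline v])=\sum_{i,j}v_ia_{ij}\bar v_j$ for $a\in M_n(\mathbb C)$. *)

theory Defs
  imports "HOL-Analysis.Analysis"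
begin

section \<open>The universal calculus on $M_n(\mathbb{C})$\<close>

text \<open>
  The index type \<open>'n\<close> has \<open>n\<close> elements. An element of $M_n(\mathbb{C})^{\otimes k}$ is given by
  its coefficients with respect to the basis $E_{a_1b_1}\otimes\cdots\otimes E_{a_kb_k}$, i.e. by a
  function on words $[(a_1,b_1),\dots,(a_k,b_k)]$ vanishing on words of any other length. Linear
  maps on tensor powers are specified on this basis.
\<close>

type_synonym 'n tens = "('n \<times> 'n) list \<Rightarrow> complex"

definition tensor_power :: "nat \<Rightarrow> 'n tens set" where
  "tensor_power k = {t. \<forall>w. length w \<noteq> k \<longrightarrow> t w = 0}"

definition E_mat :: "'n \<times> 'n \<Rightarrow> complex ^ 'n::finite ^ 'n" where
  "E_mat ij = (\<chi> r c. if (r, c) = ij then 1 else 0)"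

text \<open>The elementary tensor $a_0\otimes\cdots\otimes a_m$ of a list of matrices.\<close>

definition elem_tensor :: "(complex ^ 'n::finite ^ 'n) list \<Rightarrow> 'n tens" where
  "elem_tensor as w =
     (if length w = length as then \<Prod>i<length as. as ! i $ fst (w ! i) $ snd (w ! i) else 0)"

definition basis_extend :: "nat \<Rightarrow> (('n \<times> 'n) list \<Rightarrow> 'n tens) \<Rightarrow> 'n::finite tens \<Rightarrow> 'n tens" where
  "basis_extend k F t = (\<lambda>u. \<Sum>w | length w = k. t w * F w u)"

definition merge_at :: "nat \<Rightarrow> (complex ^ 'n::finite ^ 'n) list \<Rightarrow> (complex ^ 'n ^ 'n) list" where
  "merge_at i as = take i as @ (as ! i ** as ! Suc i) # drop (Suc (Suc i)) as"

definition insert_one_at :: "nat \<Rightarrow> (complex ^ 'n::finite ^ 'n) list \<Rightarrow> (complex ^ 'n ^ 'n) list" where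
  "insert_one_at k as = take k as @ mat 1 # drop k as"

definition mult_neighbours :: "nat \<Rightarrow> nat \<Rightarrow> 'n::finite tens \<Rightarrow> 'n tens" where
  "mult_neighbours k i = basis_extend k (\<lambda>w. elem_tensor (merge_at i (map E_mat w)))"

definition Omega_uni :: "nat \<Rightarrow> 'n::finite tens set" where
  "Omega_uni m = {t \<in> tensor_power (Suc m). \<forall>i<m. mult_neighbours (Suc m) i t = (\<lambda>_. 0)}"

definition d_uni :: "nat \<Rightarrow> 'n::finite tens \<Rightarrow> 'n tens" where
  "d_uni m = basis_extend (Suc m)
     (\<lambda>w u. \<Sum>k\<le>Suc m. (-1) ^ k * elem_tensor (insert_one_at k (map E_mat w)) u)"

section \<open>Differential forms on $\mathbb{CP}^{n-1}$\<close>

text \<open>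
  Forms are written in homogeneous coordinates. Let \<open>\<pi>\<close> be the holomorphic submersion
  $\mathbb{C}^n\setminus\{0\}\to\mathbb{CP}^{n-1}$, $z\mapsto[z]$. For an \<open>m\<close>-form \<open>\<omega>\<close>, the number
  \<open>\<omega> z h\<close> is its value at the point $[z]$ on the tangent vectors
  $d\pi_z(h_0),\dots,d\pi_z(h_{m-1})$. Values at \<open>z = 0\<close> are irrelevant.
  Since \<open>\<pi>\<close> is a holomorphic submersion, smoothness, exterior derivative, wedge
  product and type decomposition may all be computed on $\mathbb{C}^n\setminus\{0\}$.
\<close>

type_synonym 'n form = "complex ^ 'n \<Rightarrow> (nat \<Rightarrow> complex ^ 'n) \<Rightarrow> complex"

primrec Ck_on :: "nat \<Rightarrow> 'a::euclidean_space set \<Rightarrow> ('a \<Rightarrow> complex) \<Rightarrow> bool" where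
  "Ck_on 0 S f \<longleftrightarrow> continuous_on S f"
| "Ck_on (Suc k) S f \<longleftrightarrow>
     f differentiable_on S \<and> (\<forall>h. Ck_on k S (\<lambda>x. frechet_derivative f (at x) h))"

text \<open>Complex-valued alternating real-multilinear maps in \<open>m\<close> arguments.\<close>

definition alternating_form :: "nat \<Rightarrow> ((nat \<Rightarrow> 'v::real_vector) \<Rightarrow> complex) \<Rightarrow> bool" where
  "alternating_form m \<eta> \<longleftrightarrow>
     (\<forall>h h'. (\<forall>i<m. h i = h' i) \<longrightarrow> \<eta> h = \<eta> h') \<and>
     (\<forall>h. \<forall>i<m. linear (\<lambda>x. \<eta> (h(i := x)))) \<and>
     (\<forall>h. \<forall>i<m. \<forall>j<m. i \<noteq> j \<and> h i = h j \<longrightarrow> \<eta> h = 0)"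

text \<open>
  The last condition says that \<open>\<omega> z h\<close> only depends on $[z]$ and the $d\pi_z(h_i)$: one has
  $d\pi_{z}(h)=d\pi_{z'}(h')$ iff $z'=cz$ and $h'=ch+az$ for some $c\neq 0$ and $a$.
\<close>

definition Omega_CP :: "nat \<Rightarrow> 'n::finite form set" where
  "Omega_CP m = {\<omega>.
     (\<forall>z. z \<noteq> 0 \<longrightarrow> alternating_form m (\<omega> z)) \<and>
     (\<forall>h k. Ck_on k (- {0}) (\<lambda>z. \<omega> z h)) \<and>
     (\<forall>z h c a. z \<noteq> 0 \<and> c \<noteq> 0 \<longrightarrow> \<omega> (c *s z) (\<lambda>i. c *s h i + a i *s z) = \<omega> z h)}"

text \<open>
  Exterior derivative and wedge product in the conventions
  $(d\omega)(h_0,\dots,h_m)=\sum_k(-1)^k D_{h_k}\,\omega(h_0,\dots,\widehat{h_k},\dots,h_m)$ for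
  constant vector fields $h_i$, and $(\alpha\wedge\beta)(h_0,h_1)=\alpha(h_0)\beta(h_1)-\alpha(h_1)\beta(h_0)$
  for one-forms.
\<close>

definition ext_d :: "nat \<Rightarrow> 'n::finite form \<Rightarrow> 'n form" where
  "ext_d m \<omega> z h =
     (\<Sum>k\<le>m. (-1) ^ k *
        frechet_derivative (\<lambda>y. \<omega> y (\<lambda>i. if i < k then h i else h (Suc i))) (at z) (h k))"

definition wedge :: "nat \<Rightarrow> nat \<Rightarrow> 'n form \<Rightarrow> 'n form \<Rightarrow> 'n form" where
  "wedge k l \<alpha> \<beta> z h =
     (\<Sum>p | p permutes {..<k + l}.
        of_int (sign p) * \<alpha> z (\<lambda>i. h (p i)) * \<beta> z (\<lambda>i. h (p (k + i)))) / (fact k * fact l)"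

primrec wedge_one_forms :: "'n form list \<Rightarrow> 'n form" where
  "wedge_one_forms [] = (\<lambda>z h. 1)"
| "wedge_one_forms (\<gamma> # \<gamma>s) = wedge 1 (length \<gamma>s) \<gamma> (wedge_one_forms \<gamma>s)"

text \<open>
  The projection $\pi^{p,q}$ on $\Omega^{p+q}$. Split each argument as
  $h=h^{1,0}+h^{0,1}$ with $h^{1,0}=\frac12(h-\mathrm{i}\,Jh)$ and $h^{0,1}=\frac12(h+\mathrm{i}\,Jh)$ in the
  complexified tangent space, where \<open>J\<close> is multiplication by $\mathrm{i}$ in $\mathbb{C}^n$. Extend \<open>\<omega> z\<close>
  complex-multilinearly and keep the terms with exactly \<open>p\<close> arguments (those indexed by
  \<open>S\<close>) of type $(1,0)$. The inner sum expands each such term; \<open>T\<close> is the set of arguments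
  in which the summand with \<open>J\<close> is chosen.
\<close>

definition type_proj :: "nat \<Rightarrow> nat \<Rightarrow> 'n::finite form \<Rightarrow> 'n form" where
  "type_proj p q \<omega> z h =
     (\<Sum>S | S \<subseteq> {..<p + q} \<and> card S = p. \<Sum>T\<in>Pow {..<p + q}.
        (\<Prod>i\<in>T. if i \<in> S then - \<i> else \<i>) * \<omega> z (\<lambda>i. if i \<in> T then \<i> *s h i else h i))
     / 2 ^ (p + q)"

text \<open>The operator $\bar\partial$ on $\Omega^{p,q}$.\<close>

definition dbar :: "nat \<Rightarrow> nat \<Rightarrow> 'n::finite form \<Rightarrow> 'n form" where
  "dbar p q \<omega> = type_proj p (Suc q) (ext_d (p + q) \<omega>)"

section \<open>The state evaluation map on forms\<close>

text \<open>$Q_{ij}=v_i\bar v_j$ at the representative $v=z/\|z\|\in S^{2n-1}$ of $[z]$.\<close>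

definition Q_fun :: "'n::finite \<Rightarrow> 'n \<Rightarrow> complex ^ 'n \<Rightarrow> complex" where
  "Q_fun i j z = (z /\<^sub>R norm z) $ i * cnj ((z /\<^sub>R norm z) $ j)"

definition dQ :: "'n::finite \<Rightarrow> 'n \<Rightarrow> 'n form" where
  "dQ i j = ext_d 0 (\<lambda>z h. Q_fun i j z)"

text \<open>The grade-zero forms $v_q\,d\bar v_s$ and $\bar v_p\,dv_r$.\<close>

definition v_dvbar :: "'n::finite \<Rightarrow> 'n \<Rightarrow> 'n form" where
  "v_dvbar q s z h = (\<Sum>k\<in>UNIV. Q_fun q k z * dQ k s z h)"

definition vbar_dv :: "'n::finite \<Rightarrow> 'n \<Rightarrow> 'n form" where
  "vbar_dv p r z h = (\<Sum>k\<in>UNIV. dQ r k z h * Q_fun k p z)"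

text \<open>
  $\Gamma^{pq}{}_{rs}=v_q(\delta_{pr}\,d\bar v_s-\bar v_sv_r\,d\bar v_p+\bar v_s\bar v_p\,dv_r)$,
  with the factors grouped into grade-zero expressions.
\<close>

definition Gam :: "'n::finite \<Rightarrow> 'n \<Rightarrow> 'n \<Rightarrow> 'n \<Rightarrow> 'n form" where
  "Gam p q r s z h =
     (if p = r then v_dvbar q s z h else 0)
     - Q_fun q s z * v_dvbar r p z h
     + Q_fun q s z * vbar_dv p r z h"

text \<open>
  The value on a basis tensor. For \<open>w = [(a\<^sub>0,b\<^sub>0),\<dots>,(a\<^sub>m,b\<^sub>m)]\<close> the list \<open>rs\<close> is
  \<open>[q\<^sub>0,\<dots>,q\<^sub>m\<^sub>-\<^sub>1,b\<^sub>m]\<close>, which for \<open>m = 0\<close> gives $v_{a_0}\bar v_{b_0}$.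
\<close>

definition phi_basis :: "('n::finite \<times> 'n) list \<Rightarrow> 'n form" where
  "phi_basis w z h =
     (\<Sum>qs | length qs = length w - 1.
        let rs = qs @ [snd (last w)] in
        Q_fun (fst (w ! 0)) (rs ! 0) z *
        wedge_one_forms
          (map (\<lambda>i. Gam (snd (w ! i)) (rs ! i) (fst (w ! Suc i)) (rs ! Suc i)) [0..<length w - 1]) z h)"

definition phi :: "nat \<Rightarrow> 'n::finite tens \<Rightarrow> 'n form" where
  "phi m t z h = (\<Sum>w | length w = Suc m. t w * phi_basis w z h)"

end

theory Submission
  imports Defs
begin

text \<open>
  Write \<open>Q\<^sub>a\<^sub>b = z\<^sub>a u\<^sub>b\<close> with \<open>u\<^sub>b = cnj z\<^sub>b / |z|\<^sup>2\<close>. The functions \<open>z\<^sub>a\<close> are holomorphic, so \<open>dbar Q\<^sub>a\<^sub>b = z\<^sub>a dbar u\<^sub>b\<close>,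
  and \<open>\<Sum> z\<^sub>a u\<^sub>a = 1\<close> gives \<open>\<Sum> z\<^sub>a dbar u\<^sub>a = 0\<close>. The grade-zero forms have pure type:
  \<open>v\<^sub>a d cnj v\<^sub>b\<close> is \<open>dbar Q\<^sub>a\<^sub>b\<close>, of type (0,1), and \<open>cnj v\<^sub>b d v\<^sub>a\<close> is \<open>del Q\<^sub>a\<^sub>b\<close>, of type (1,0).

  The projection to type \<open>(0,m)\<close> of a wedge product of one-forms is the wedge product of the (0,1)-parts of the
  factors (\<open>type_proj_alt_prod\<close>). The (0,1)-part of the form \<open>Gam p q r s\<close> is
  \<open>z\<^sub>q (\<delta>\<^sub>p\<^sub>r dbar u\<^sub>s - u\<^sub>s z\<^sub>r dbar u\<^sub>p)\<close>. In the chain of such factors that defines \<open>phi\<close>, the scalar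
  \<open>z\<^sub>q\<close> of each factor is summed against the last index of the factor before it. There
  \<open>\<Sum> z\<^sub>q dbar u\<^sub>q = 0\<close> removes the first term and \<open>\<Sum> z\<^sub>q u\<^sub>q = 1\<close> collapses the second one
  (\<open>chain_contraction\<close>). Only the last factor keeps its \<open>\<delta>\<close>-term, and this term factors through the
  multiplication of the last two tensor factors, so that it vanishes on the universal calculus. Hence
  (\<open>type_proj_phi\<close>), for \<open>\<xi> = \<Sum> \<xi>\<^sub>w E\<^sub>w\<^sub>0 \<otimes> ... \<otimes> E\<^sub>w\<^sub>m\<close>, the \<open>(0,m)\<close>-part of \<open>phi \<xi>\<close> is
  \<open>(-1)\<^sup>m \<Sum> \<xi>\<^sub>w (dbar Q\<^sub>w\<^sub>0 \<and> ... \<and> dbar Q\<^sub>w\<^sub>m\<^sub>-\<^sub>1) Q\<^sub>w\<^sub>m\<close>.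

  Both sides of the cochain identity are now equal to \<open>\<Sum> \<xi>\<^sub>w dbar Q\<^sub>w\<^sub>0 \<and> ... \<and> dbar Q\<^sub>w\<^sub>m\<close>. On the one
  hand \<open>dbar\<close> differentiates only the scalar \<open>Q\<^sub>w\<^sub>m\<close>, because \<open>dbar dbar Q = 0\<close>
  (\<open>dbar_type_proj_phi\<close>). On the other hand \<open>d \<xi>\<close> is again in the universal calculus
  (\<open>d_uni_in_Omega_uni\<close>), so the same formula applies in degree \<open>m + 1\<close>. An inserted unit
  \<open>1 = \<Sum> E\<^sub>c\<^sub>c\<close> in a slot before the last one contributes \<open>dbar (\<Sum> Q\<^sub>c\<^sub>c) = 0\<close>, and in the last slot it
  contributes \<open>\<Sum> Q\<^sub>c\<^sub>c = 1\<close> (\<open>type_proj_phi_d_uni\<close>).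

  The map \<open>phi\<close> takes values in forms on projective space (\<open>phi_in_Omega_CP\<close>) because \<open>Q\<close>, \<open>dbar Q\<close> and
  \<open>del Q\<close> are invariant under rescaling of \<open>z\<close> and blind to tangent vectors of the fibre.

  All forms live on the punctured affine space, where \<open>Q\<close>, \<open>dbar Q\<close> and the derivative of \<open>dbar Q\<close> have
  explicit rational expressions in \<open>z\<close> and \<open>cnj z\<close>. Wedge products of one-forms are handled through
  their expansion as signed sums over permutations.
\<close>

section \<open>Words, tensors and the universal differential\<close>

lemma finite_words [simp]: "finite {w :: 'a::finite list. length w = n}"
  using finite_lists_length_eq[OF finite, of UNIV n] by simp

lemma sum_words_Suc:
  fixes f :: "'a::finite list \<Rightarrow> 'b::comm_monoid_add"
  shows "(\<Sum>w | length w = Suc n. f w) = (\<Sum>x\<in>UNIV. \<Sum>w | length w = n. f (x # w))"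
proof -
  have "(\<Sum>w | length w = Suc n. f w)
      = (\<Sum>p\<in>UNIV \<times> {w. length w = n}. f (fst p # snd p))"
    by (rule sum.reindex_bij_witness[where i = "\<lambda>p. fst p # snd p" and j = "\<lambda>w. (hd w, tl w)"])
       (auto simp: length_Suc_conv)
  then show ?thesis
    by (simp add: sum.cartesian_product case_prod_beta)
qed

lemma sum_words_prod:
  fixes f :: "nat \<Rightarrow> 'a::finite \<Rightarrow> 'b::comm_semiring_1"
  shows "(\<Sum>w | length w = n. \<Prod>i<n. f i (w ! i)) = (\<Prod>i<n. \<Sum>x\<in>UNIV. f i x)"
proof (induction n arbitrary: f)
  case (Suc n)
  show ?case
    by (simp only: sum_words_Suc prod.lessThan_Suc_shift nth_Cons_0 nth_Cons_Suc o_def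
        sum_distrib_left[symmetric] sum_distrib_right[symmetric] Suc.IH[of "\<lambda>i. f (Suc i)"])
qed simp

lemma E_mat_component: "E_mat ij $ r $ c = of_bool ((r, c) = ij)"
  by (simp add: E_mat_def)

lemma elem_tensor_Nil: "elem_tensor [] u = of_bool (u = [])"
  by (simp add: elem_tensor_def)

lemma elem_tensor_Cons_Nil: "elem_tensor (a # as) [] = 0"
  by (simp add: elem_tensor_def)

lemma elem_tensor_Cons:
  "elem_tensor (a # as) (x # u) = a $ fst x $ snd x * elem_tensor as u"
  by (simp add: elem_tensor_def prod.lessThan_Suc_shift del: prod.lessThan_Suc)

lemma elem_tensor_split:
  "elem_tensor (as @ a # bs) u =
     (if length as < length u
      then a $ fst (u ! length as) $ snd (u ! length as)
           * elem_tensor (as @ bs) (take (length as) u @ drop (Suc (length as)) u)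
      else 0)"
proof (induction as arbitrary: u)
  case Nil
  show ?case by (cases u) (simp_all add: elem_tensor_Cons elem_tensor_Cons_Nil)
next
  case (Cons c as)
  show ?case by (cases u) (simp_all add: elem_tensor_Cons elem_tensor_Cons_Nil Cons.IH)
qed

lemma elem_tensor_E_mat: "elem_tensor (map E_mat w) u = of_bool (u = w)"
proof (induction w arbitrary: u)
  case Nil
  show ?case by (simp add: elem_tensor_Nil)
next
  case (Cons x w)
  show ?case by (cases u) (auto simp: elem_tensor_Cons elem_tensor_Cons_Nil Cons.IH E_mat_component)
qed

lemma E_mat_mult:
  fixes a b c d :: "'n::finite"
  shows "E_mat (a, b) ** E_mat (c, d) = (if b = c then E_mat (a, d) else 0)"
proof -
  have *: "(if P then 1 else 0) * (if Q then 1 else 0) = (if P \<and> Q then 1 else (0::complex))" for P Q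
    by simp
  have "(\<Sum>k\<in>UNIV. if (i = a \<and> k = b) \<and> k = c \<and> j = d then 1 else (0::complex))
      = (\<Sum>k\<in>UNIV. if k = b then (if i = a \<and> b = c \<and> j = d then 1 else 0) else 0)" for i j
    by (rule sum.cong) auto
  then show ?thesis
    by (simp add: vec_eq_iff matrix_matrix_mult_def E_mat_def * sum.delta)
qed

lemma mat_1_component_E_mat:
  "(mat 1 :: complex ^ 'n::finite ^ 'n) $ i $ j = (\<Sum>c\<in>UNIV. E_mat (c, c) $ i $ j)"
proof -
  have "(\<Sum>c\<in>UNIV. if i = c \<and> j = c then 1 else (0::complex))
      = (\<Sum>c\<in>UNIV. if c = i then (if i = j then 1 else 0) else 0)"
    by (rule sum.cong) auto
  then show ?thesis by (simp add: mat_def E_mat_def sum.delta)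
qed

text \<open>
  The unit is \<open>\<Sum> E\<^sub>c\<^sub>c\<close>, so inserting it turns a basis tensor into a sum of basis tensors.
\<close>

lemma elem_tensor_insert_one:
  "elem_tensor (insert_one_at k (map E_mat w)) u
     = (\<Sum>c\<in>UNIV. of_bool (u = take k w @ (c, c) # drop k w))"
proof -
  have "elem_tensor (insert_one_at k (map E_mat w)) u
      = (\<Sum>c\<in>UNIV. elem_tensor (map E_mat (take k w @ (c, c) # drop k w)) u)"
    by (simp add: insert_one_at_def elem_tensor_split mat_1_component_E_mat sum_distrib_right
        take_map drop_map)
  then show ?thesis by (simp only: elem_tensor_E_mat)
qed

lemma merge_at_E_mat:
  assumes "Suc i < length w"
  shows "merge_at i (map E_mat w)
       = take i (map E_mat w) @ (if snd (w ! i) = fst (w ! Suc i)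
            then E_mat (fst (w ! i), snd (w ! Suc i)) else 0) # drop (Suc (Suc i)) (map E_mat w)"
  using assms E_mat_mult[of "fst (w ! i)" "snd (w ! i)" "fst (w ! Suc i)" "snd (w ! Suc i)"]
  by (simp add: merge_at_def)

lemma elem_tensor_merge:
  assumes "Suc i < length w"
  shows "elem_tensor (merge_at i (map E_mat w)) u
       = of_bool (snd (w ! i) = fst (w ! Suc i) \<and>
                  u = take i w @ (fst (w ! i), snd (w ! Suc i)) # drop (Suc (Suc i)) w)"
proof (cases "snd (w ! i) = fst (w ! Suc i)")
  case True
  then have "merge_at i (map E_mat w)
     = map E_mat (take i w @ (fst (w ! i), snd (w ! Suc i)) # drop (Suc (Suc i)) w)"
    using assms by (simp add: merge_at_E_mat take_map drop_map)
  then show ?thesis using True by (simp only: elem_tensor_E_mat) simp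
next
  case False
  then show ?thesis using assms by (simp add: merge_at_E_mat elem_tensor_split)
qed

text \<open>
  The transpose of the universal differential. A linear functional on tensors is given by its values
  \<open>F\<close> on basis tensors. Pulled back along \<open>d\<close>, it takes on a basis tensor the alternating sum of the values
  on all insertions of a unit.
\<close>

lemma sum_d_uni:
  fixes F :: "('n::finite \<times> 'n) list \<Rightarrow> complex"
  shows "(\<Sum>u | length u = Suc (Suc m). d_uni m t u * F u)
       = (\<Sum>w | length w = Suc m. t w * (\<Sum>k\<le>Suc m. (-1) ^ k *
            (\<Sum>c\<in>UNIV. F (take k w @ (c, c) # drop k w))))"
proof -
  have *: "(\<Sum>u | length u = Suc (Suc m).
             elem_tensor (insert_one_at k (map E_mat w)) u * F u)
        = (\<Sum>c\<in>UNIV. F (take k w @ (c, c) # drop k w))"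
    if w: "length w = Suc m" and k: "k \<le> Suc m" for k and w :: "('n \<times> 'n) list"
  proof -
    have "(\<Sum>u | length u = Suc (Suc m).
             elem_tensor (insert_one_at k (map E_mat w)) u * F u)
        = (\<Sum>c\<in>UNIV. \<Sum>u | length u = Suc (Suc m).
             if u = take k w @ (c, c) # drop k w then F u else 0)"
      unfolding elem_tensor_insert_one sum_distrib_right
      by (subst sum.swap) (intro sum.cong; simp)
    also have "\<dots> = (\<Sum>c\<in>UNIV. F (take k w @ (c, c) # drop k w))"
      using w k by (intro sum.cong refl) (simp add: sum.delta)
    finally show ?thesis .
  qed
  have "(\<Sum>u | length u = Suc (Suc m). d_uni m t u * F u)
      = (\<Sum>w | length w = Suc m. \<Sum>u | length u = Suc (Suc m). \<Sum>k\<le>Suc m.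
           t w * ((-1) ^ k * (elem_tensor (insert_one_at k (map E_mat w)) u * F u)))"
    unfolding d_uni_def basis_extend_def sum_distrib_right
    by (subst sum.swap)
       (simp only: sum_distrib_left sum_distrib_right mult.assoc)
  also have "\<dots> = (\<Sum>w | length w = Suc m. t w * (\<Sum>k\<le>Suc m. (-1) ^ k *
           (\<Sum>u | length u = Suc (Suc m). elem_tensor (insert_one_at k (map E_mat w)) u * F u)))"
    by (subst sum.swap) (simp only: sum_distrib_left)
  also have "\<dots> = (\<Sum>w | length w = Suc m. t w * (\<Sum>k\<le>Suc m. (-1) ^ k *
            (\<Sum>c\<in>UNIV. F (take k w @ (c, c) # drop k w))))"
    by (intro sum.cong refl arg_cong2[where f = "(*)"] *) auto
  finally show ?thesis .
qed

text \<open>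
  A linear functional that factors through the multiplication of the factors \<open>i\<close> and \<open>i + 1\<close> vanishes
  on the kernel of this multiplication. The values of the functional on the tensors of length
  \<open>K - 1\<close> are given by \<open>H\<close>.
\<close>

lemma sum_mult_neighbours_eq_0:
  fixes t :: "'n::finite tens"
  assumes "mult_neighbours K i t = (\<lambda>_. 0)" and i: "Suc i < K"
  shows "(\<Sum>w | length w = K. t w * (if snd (w ! i) = fst (w ! Suc i)
            then H (take i w @ (fst (w ! i), snd (w ! Suc i)) # drop (Suc (Suc i)) w) else 0)) = 0"
proof -
  let ?U = "{u :: ('n \<times> 'n) list. length u = K - 1}"
  have "(\<Sum>u\<in>?U. elem_tensor (merge_at i (map E_mat w)) u * H u)
     = (if snd (w ! i) = fst (w ! Suc i)
        then H (take i w @ (fst (w ! i), snd (w ! Suc i)) # drop (Suc (Suc i)) w) else 0)"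
    if w: "length w = K" for w
  proof -
    let ?u = "take i w @ (fst (w ! i), snd (w ! Suc i)) # drop (Suc (Suc i)) w"
    have "(\<Sum>u\<in>?U. elem_tensor (merge_at i (map E_mat w)) u * H u)
        = (\<Sum>u\<in>?U. if u = ?u then (if snd (w ! i) = fst (w ! Suc i) then H ?u else 0) else 0)"
      using i w by (intro sum.cong refl) (auto simp: elem_tensor_merge)
    also have "\<dots> = (if snd (w ! i) = fst (w ! Suc i) then H ?u else 0)"
      using i w by (subst sum.delta) auto
    finally show ?thesis .
  qed
  then have "(\<Sum>w | length w = K. t w * (if snd (w ! i) = fst (w ! Suc i)
            then H (take i w @ (fst (w ! i), snd (w ! Suc i)) # drop (Suc (Suc i)) w) else 0))
     = (\<Sum>w | length w = K. t w * (\<Sum>u\<in>?U. elem_tensor (merge_at i (map E_mat w)) u * H u))"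
    by (intro sum.cong) auto
  also have "\<dots> = (\<Sum>u\<in>?U. mult_neighbours K i t u * H u)"
    unfolding mult_neighbours_def basis_extend_def sum_distrib_right sum_distrib_left
    by (subst sum.swap) (simp only: mult.assoc)
  also have "\<dots> = 0" using assms(1) by simp
  finally show ?thesis .
qed

text \<open>
  Multiply the factors \<open>i\<close> and \<open>i + 1\<close> after inserting a unit at position \<open>k\<close>. For \<open>k = i\<close> and
  \<open>k = i + 1\<close> the unit is absorbed and the two results cancel by their signs. For all other \<open>k\<close> the two
  operations commute up to a shift of one of the positions, and \<open>\<xi>\<close> is killed by the multiplication.
\<close>

lemma d_uni_in_Omega_uni:
  fixes \<xi> :: "'n::finite tens"
  assumes "\<xi> \<in> Omega_uni m"
  shows "d_uni m \<xi> \<in> Omega_uni (Suc m)"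
proof -
  have \<xi>: "mult_neighbours (Suc m) i \<xi> = (\<lambda>_. 0)" if "i < m" for i
    using assms that by (simp add: Omega_uni_def)
  have tensor: "d_uni m \<xi> \<in> tensor_power (Suc (Suc m))"
    unfolding tensor_power_def
  proof (clarify)
    fix u :: "('n \<times> 'n) list" assume "length u \<noteq> Suc (Suc m)"
    then have "elem_tensor (insert_one_at k (map E_mat w)) u = 0"
      if "length w = Suc m" "k \<le> Suc m" for k and w :: "('n \<times> 'n) list"
      using that by (auto simp: elem_tensor_def insert_one_at_def)
    then show "d_uni m \<xi> u = 0"
      by (simp add: d_uni_def basis_extend_def)
  qed
  have "mult_neighbours (Suc (Suc m)) i (d_uni m \<xi>) u = 0" if i: "i < Suc m" for i u
  proof -
    define M where "M k w = (\<Sum>c\<in>UNIV.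
      elem_tensor (merge_at i (map E_mat (take k w @ (c, c) # drop k w))) u)"
      for k and w :: "('n \<times> 'n) list"
    have eq: "mult_neighbours (Suc (Suc m)) i (d_uni m \<xi>) u
        = (\<Sum>k\<le>Suc m. (-1) ^ k * (\<Sum>w | length w = Suc m. \<xi> w * M k w))"
      unfolding mult_neighbours_def basis_extend_def sum_d_uni M_def[symmetric]
      unfolding sum_distrib_left
      by (subst sum.swap) (simp only: mult.left_commute)
    \<comment> \<open>The unit stands before both factors: they were at positions \<open>i - 1\<close> and \<open>i\<close> in \<open>w\<close>.\<close>
    have before: "(\<Sum>w | length w = Suc m. \<xi> w * M k w) = 0" if k: "k < i" for k
    proof -
      obtain j where j: "i = Suc j" using k by (cases i) auto
      let ?f = "if k < length u then \<Sum>c\<in>UNIV. (E_mat (c, c) :: complex^'n^'n) $ fst (u ! k) $ snd (u ! k) else 0"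
      have "M k w = elem_tensor (merge_at j (map E_mat w)) (take k u @ drop (Suc k) u) * ?f"
        if w: "length w = Suc m" for w
      proof -
        have "merge_at i (map E_mat (take k w @ (c, c) # drop k w))
            = take k (merge_at j (map E_mat w)) @ E_mat (c, c) # drop k (merge_at j (map E_mat w))"
          for c
          using w k i j
          by (simp add: merge_at_def nth_append take_map drop_map min_def nth_Cons' Suc_diff_le
               drop_take)
        moreover have "length (take k (merge_at j (map E_mat w))) = k"
          using w k i j by (simp add: merge_at_def)
        ultimately show ?thesis
          unfolding M_def by (simp add: elem_tensor_split sum_distrib_left mult.commute)
      qed
      then have "(\<Sum>w | length w = Suc m. \<xi> w * M k w)
         = mult_neighbours (Suc m) j \<xi> (take k u @ drop (Suc k) u) * ?f"
        unfolding mult_neighbours_def basis_extend_def sum_distrib_right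
        by (intro sum.cong) (auto simp: mult.assoc)
      then show ?thesis using \<xi>[of j] i j by simp
    qed
    \<comment> \<open>The unit stands after both factors: multiplying them moves it to position \<open>k - 1\<close>.\<close>
    have after: "(\<Sum>w | length w = Suc m. \<xi> w * M k w) = 0" if k: "Suc i < k" "k \<le> Suc m" for k
    proof -
      obtain j where j: "k = Suc j" using k by (cases k) auto
      let ?f = "if j < length u then \<Sum>c\<in>UNIV. (E_mat (c, c) :: complex^'n^'n) $ fst (u ! j) $ snd (u ! j) else 0"
      have "M k w = elem_tensor (merge_at i (map E_mat w)) (take j u @ drop (Suc j) u) * ?f"
        if w: "length w = Suc m" for w
      proof -
        have "merge_at i (map E_mat (take k w @ (c, c) # drop k w))
            = take j (merge_at i (map E_mat w)) @ E_mat (c, c) # drop j (merge_at i (map E_mat w))"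
          for c
          using w k i j
          by (simp add: merge_at_def nth_append take_map drop_map min_def nth_Cons' Suc_diff_le
               take_Cons' drop_Cons' drop_take)
        moreover have "length (take j (merge_at i (map E_mat w))) = j"
          using w k i j by (simp add: merge_at_def)
        ultimately show ?thesis
          unfolding M_def by (simp add: elem_tensor_split sum_distrib_left mult.commute)
      qed
      then have "(\<Sum>w | length w = Suc m. \<xi> w * M k w)
         = mult_neighbours (Suc m) i \<xi> (take j u @ drop (Suc j) u) * ?f"
        unfolding mult_neighbours_def basis_extend_def sum_distrib_right
        by (intro sum.cong) (auto simp: mult.assoc)
      then show ?thesis using \<xi>[of i] k by simp
    qed
    have here: "M k w = of_bool (u = w)" if w: "length w = Suc m" and k: "k = i \<or> k = Suc i" for k w
    proof -
      have "M k w = (\<Sum>c\<in>UNIV. if c = (if k = i then fst (w ! i) else snd (w ! i))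
         then of_bool (u = w) else 0)"
        unfolding M_def
      proof (intro sum.cong refl)
        fix c :: 'n
        have wi: "w = take i w @ w ! i # drop (Suc i) w"
          using w i by (simp add: id_take_nth_drop)
        show "elem_tensor (merge_at i (map E_mat (take k w @ (c, c) # drop k w))) u
          = (if c = (if k = i then fst (w ! i) else snd (w ! i)) then of_bool (u = w) else 0)"
        proof -
          let ?v = "take k w @ (c, c) # drop k w"
          have len: "Suc i < length ?v" using w i by simp
          have "?v ! i = (if k = i then (c, c) else w ! i)"
            "?v ! Suc i = (if k = i then w ! i else (c, c))"
            "take i ?v = take i w" "drop (Suc (Suc i)) ?v = drop (Suc i) w"
            using w i k by (auto simp: nth_append min_def nth_Cons' Suc_diff_le)
          then show ?thesis
            unfolding elem_tensor_merge[OF len] using k wi by auto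
        qed
      qed
      then show ?thesis by simp
    qed
    have "(\<Sum>k\<le>Suc m. (-1) ^ k * (\<Sum>w | length w = Suc m. \<xi> w * M k w))
        = (\<Sum>k\<in>{i, Suc i}. (-1) ^ k * (\<Sum>w | length w = Suc m. \<xi> w * M k w))"
    proof (intro sum.mono_neutral_right ballI)
      fix k assume "k \<in> {..Suc m} - {i, Suc i}"
      then have "k < i \<or> Suc i < k \<and> k \<le> Suc m" by auto
      then have "(\<Sum>w | length w = Suc m. \<xi> w * M k w) = 0"
        using before after by blast
      then show "(-1) ^ k * (\<Sum>w | length w = Suc m. \<xi> w * M k w) = 0" by simp
    qed (use i in auto)
    also have "\<dots> = 0"
      using here by simp
    finally show ?thesis using eq by simp
  qed
  with tensor show ?thesis by (auto simp: Omega_uni_def)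
qed

section \<open>Alternating products of covectors\<close>

text \<open>
  The wedge product of the covectors \<open>c 0, \<dots>, c (n - 1)\<close>, i.e. the determinant of the matrix of
  the values \<open>c i (h j)\<close>.
\<close>

definition alt_prod :: "nat \<Rightarrow> (nat \<Rightarrow> 'v \<Rightarrow> complex) \<Rightarrow> (nat \<Rightarrow> 'v) \<Rightarrow> complex" where
  "alt_prod n c h =
     (\<Sum>p | p permutes {..<n}. of_int (sign p) * (\<Prod>i<n. c i (h (p i))))"

lemma sign_compose_permutes:
  fixes p q :: "nat \<Rightarrow> nat"
  assumes "p permutes {..<m}" "q permutes {..<n}"
  shows "sign (p \<circ> q) = sign p * sign q"
  using assms by (intro sign_compose) (auto intro: permutes_imp_permutation)

text \<open>
  The transposition pairs off permutations of opposite sign. This version exchanges the values \<open>i\<close>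
  and \<open>j\<close> of the permutations, the next one the arguments.
\<close>

lemma signed_sum_eq_0_left:
  fixes F :: "(nat \<Rightarrow> nat) \<Rightarrow> complex"
  assumes ij: "i < n" "j < n" "i \<noteq> j"
    and F: "\<And>p. p permutes {..<n} \<Longrightarrow> F (Transposition.transpose i j \<circ> p) = F p"
  shows "(\<Sum>p | p permutes {..<n}. of_int (sign p) * F p) = 0"
proof -
  have t: "Transposition.transpose i j permutes {..<n}"
    using ij by (intro permutes_swap_id) auto
  have "(\<Sum>p | p permutes {..<n}. of_int (sign p) * F p)
      = (\<Sum>p | p permutes {..<n}. of_int (sign (Transposition.transpose i j \<circ> p)) * F (Transposition.transpose i j \<circ> p))"
    by (rule setum_permutations_compose_left[OF t])
  also have "\<dots> = - (\<Sum>p | p permutes {..<n}. of_int (sign p) * F p)"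
    unfolding sum_negf[symmetric]
    using ij by (intro sum.cong) (simp_all add: F sign_compose_permutes[OF t] sign_swap_id)
  finally show ?thesis by (simp add: eq_neg_iff_add_eq_0)
qed

lemma signed_sum_eq_0_right:
  fixes F :: "(nat \<Rightarrow> nat) \<Rightarrow> complex"
  assumes ij: "i < n" "j < n" "i \<noteq> j"
    and F: "\<And>p. p permutes {..<n} \<Longrightarrow> F (p \<circ> Transposition.transpose i j) = F p"
  shows "(\<Sum>p | p permutes {..<n}. of_int (sign p) * F p) = 0"
proof -
  have t: "Transposition.transpose i j permutes {..<n}"
    using ij by (intro permutes_swap_id) auto
  have "(\<Sum>p | p permutes {..<n}. of_int (sign p) * F p)
      = (\<Sum>p | p permutes {..<n}. of_int (sign (p \<circ> Transposition.transpose i j)) * F (p \<circ> Transposition.transpose i j))"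
    by (rule sum_permutations_compose_right[OF t])
  also have "\<dots> = - (\<Sum>p | p permutes {..<n}. of_int (sign p) * F p)"
    unfolding sum_negf[symmetric]
    using ij by (intro sum.cong) (simp_all add: F sign_compose_permutes[OF _ t] sign_swap_id)
  finally show ?thesis by (simp add: eq_neg_iff_add_eq_0)
qed

text \<open>
  The cycle that moves \<open>n\<close> to position \<open>k\<close> and keeps the order of the other elements.
\<close>

definition move_last :: "nat \<Rightarrow> nat \<Rightarrow> nat \<Rightarrow> nat" where
  "move_last n k i = (if i < k then i else if i < n then Suc i else if i = n then k else i)"

lemma move_last_permutes_sign:
  assumes "k \<le> n"
  shows "move_last n k permutes {..<Suc n} \<and> sign (move_last n k) = (-1) ^ (n - k)"
  using assms
proof (induction rule: inc_induct)
  case base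
  have eq: "move_last n n = id" by (auto simp: move_last_def fun_eq_iff)
  show ?case unfolding eq by (simp only: permutes_id sign_id diff_self_eq_0 power_0 simp_thms)
next
  case (step k)
  have eq: "move_last n k = Transposition.transpose k (Suc k) \<circ> move_last n (Suc k)"
    using step.hyps by (auto simp: move_last_def fun_eq_iff Transposition.transpose_def)
  have t: "Transposition.transpose k (Suc k) permutes {..<Suc n}"
    using step.hyps by (intro permutes_swap_id) auto
  have "n - k = Suc (n - Suc k)" using step.hyps by simp
  then show ?case
    unfolding eq
    using permutes_compose[OF conjunct1[OF step.IH] t]
      sign_compose_permutes[OF t conjunct1[OF step.IH]] step.IH
    by (simp add: sign_swap_id del: o_apply)
qed

text \<open>
  Every permutation of \<open>n + 1\<close> elements is uniquely the composition of a permutation of the first \<open>n\<close>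
  elements with the cycle that moves \<open>n\<close> to its prescribed image \<open>k\<close>. This is the Laplace
  expansion of a determinant along its last row, on the level of permutations.
\<close>

lemma signed_sum_Suc:
  fixes F :: "(nat \<Rightarrow> nat) \<Rightarrow> complex"
  shows "(\<Sum>\<sigma> | \<sigma> permutes {..<Suc n}. of_int (sign \<sigma>) * F \<sigma>)
       = (\<Sum>k\<le>n. \<Sum>p | p permutes {..<n}. (-1) ^ (n - k) * of_int (sign p) * F (move_last n k \<circ> p))"
proof -
  have move_last: "move_last n k permutes {..<Suc n}" if "k \<le> n" for k
    using move_last_permutes_sign[OF that] by simp
  have up: "p permutes {..<Suc n}" if "p permutes {..<n}" for p
    using that by (rule permutes_subset) auto
  have fixn: "p n = n" if "p permutes {..<n}" for p
    using that by (simp add: permutes_not_in)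
  have le: "\<sigma> n \<le> n" if "\<sigma> permutes {..<Suc n}" for \<sigma>
    using permutes_in_image[OF that, of n] by simp
  have down: "inv (move_last n (\<sigma> n)) \<circ> \<sigma> permutes {..<n}" if \<sigma>: "\<sigma> permutes {..<Suc n}" for \<sigma>
  proof (rule permutes_superset)
    show "inv (move_last n (\<sigma> n)) \<circ> \<sigma> permutes {..<Suc n}"
      by (intro permutes_compose permutes_inv move_last le \<sigma>)
    have "move_last n (\<sigma> n) n = \<sigma> n" using le[OF \<sigma>] by (auto simp: move_last_def)
    then have "inv (move_last n (\<sigma> n)) (\<sigma> n) = n"
      using permutes_inv_eq[OF move_last[OF le[OF \<sigma>]]] by simp
    then show "(inv (move_last n (\<sigma> n)) \<circ> \<sigma>) x = x" if "x \<in> {..<Suc n} - {..<n}" for x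
      using that by (simp add: less_Suc_eq)
  qed
  have "(\<Sum>k\<le>n. \<Sum>p | p permutes {..<n}. (-1) ^ (n - k) * of_int (sign p) * F (move_last n k \<circ> p))
      = (\<Sum>(k, p)\<in>{..n} \<times> {p. p permutes {..<n}}.
           (-1) ^ (n - k) * of_int (sign p) * F (move_last n k \<circ> p))"
    by (rule sum.cartesian_product)
  also have "\<dots> = (\<Sum>\<sigma> | \<sigma> permutes {..<Suc n}. of_int (sign \<sigma>) * F \<sigma>)"
  proof (rule sum.reindex_bij_witness[where i = "\<lambda>\<sigma>. (\<sigma> n, inv (move_last n (\<sigma> n)) \<circ> \<sigma>)"
        and j = "\<lambda>(k, p). move_last n k \<circ> p"], goal_cases)
    case (1 a)
    then obtain k p where a: "a = (k, p)" "k \<le> n" "p permutes {..<n}" by auto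
    then have "(move_last n k \<circ> p) n = k" using fixn[OF a(3)] by (simp add: move_last_def)
    then show ?case
      using a permutes_inv_o(2)[OF move_last, of k] by (simp add: o_assoc)
  next
    case (2 a)
    then show ?case
      using permutes_compose[OF up move_last] by auto
  next
    case (3 \<sigma>)
    then show ?case
      using permutes_inv_o(1)[OF move_last[OF le], of \<sigma>] by (simp add: o_assoc)
  next
    case (4 \<sigma>)
    then show ?case using down le by auto
  next
    case (5 a)
    then show ?case
      using sign_compose_permutes[OF move_last up] move_last_permutes_sign by auto
  qed
  finally show ?thesis by simp
qed

definition lift_perm :: "(nat \<Rightarrow> nat) \<Rightarrow> nat \<Rightarrow> nat" where
  "lift_perm q i = (case i of 0 \<Rightarrow> 0 | Suc i \<Rightarrow> Suc (q i))"

lemma lift_perm_permutes_sign: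
  assumes "q permutes {..<n}"
  shows "lift_perm q permutes {..<Suc n} \<and> sign (lift_perm q) = sign q"
  using assms finite_lessThan
proof (induction rule: permutes_induct)
  case id
  have eq: "lift_perm id = id" by (auto simp: lift_perm_def fun_eq_iff split: nat.splits)
  show ?case unfolding eq by (simp only: permutes_id simp_thms)
next
  case (swap a b p)
  have eq: "lift_perm (Transposition.transpose a b \<circ> p) = Transposition.transpose (Suc a) (Suc b) \<circ> lift_perm p"
    by (auto simp: lift_perm_def fun_eq_iff Transposition.transpose_def split: nat.splits)
  have t: "Transposition.transpose (Suc a) (Suc b) permutes {..<Suc n}" "Transposition.transpose a b permutes {..<n}"
    using swap.hyps by (auto intro!: permutes_swap_id)
  have p: "lift_perm p permutes {..<Suc n}" "sign (lift_perm p) = sign p"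
    using swap.IH by auto
  have "sign (Transposition.transpose (Suc a) (Suc b) \<circ> lift_perm p) = sign (Transposition.transpose a b \<circ> p)"
    using sign_compose_permutes[OF t(1) p(1)] sign_compose_permutes[OF t(2) \<open>p permutes {..<n}\<close>]
    by (simp only: p sign_swap_id nat.inject)
  then show ?case
    unfolding eq using permutes_compose[OF p(1) t(1)] by blast
qed

text \<open>
  The definition of the wedge product sums over all permutations of the \<open>n + 1\<close> arguments and the
  second factor contains one more sum over permutations of \<open>n\<close> arguments. The inner permutation can
  be absorbed into the outer one, and the \<open>n!\<close> equal results cancel the denominator.
\<close>

lemma wedge_alt_prod:
  assumes \<alpha>: "\<And>h h'. h 0 = h' 0 \<Longrightarrow> \<alpha> z h = \<alpha> z h'"
    and \<beta>: "\<And>h. \<beta> z h = alt_prod n c h"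
  shows "wedge 1 n \<alpha> \<beta> z h = alt_prod (Suc n) (case_nat (\<lambda>x. \<alpha> z (\<lambda>_. x)) c) h"
proof -
  let ?A = "\<lambda>p. of_int (sign p) * \<alpha> z (\<lambda>_. h (p 0)) * (\<Prod>i<n. c i (h (p (Suc i))))"
  have \<alpha>': "\<alpha> z (\<lambda>i. h (p i)) = \<alpha> z (\<lambda>_. h (p 0))" for p
    by (rule \<alpha>) simp
  have alt: "alt_prod (Suc n) (case_nat (\<lambda>x. \<alpha> z (\<lambda>_. x)) c) h
     = (\<Sum>p | p permutes {..<Suc n}. ?A p)"
    by (simp add: alt_prod_def prod.lessThan_Suc_shift mult.assoc del: prod.lessThan_Suc)
  have "wedge 1 n \<alpha> \<beta> z h * fact n
      = (\<Sum>p | p permutes {..<Suc n}. \<Sum>q | q permutes {..<n}.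
           of_int (sign p) * \<alpha> z (\<lambda>_. h (p 0)) * (of_int (sign q) * (\<Prod>i<n. c i (h (p (Suc (q i)))))))"
    unfolding wedge_def \<beta> alt_prod_def by (subst \<alpha>') (simp add: sum_distrib_left)
  also have "\<dots> = (\<Sum>q | q permutes {..<n}. \<Sum>p | p permutes {..<Suc n}.
           of_int (sign p) * \<alpha> z (\<lambda>_. h (p 0)) * (of_int (sign q) * (\<Prod>i<n. c i (h (p (Suc (q i)))))))"
    by (rule sum.swap)
  also have "\<dots> = (\<Sum>q | q permutes {..<n}. \<Sum>p | p permutes {..<Suc n}. ?A (p \<circ> lift_perm q))"
  proof (rule sum.cong[OF refl], rule sum.cong[OF refl])
    fix q p assume "q \<in> {q. q permutes {..<n}}" "p \<in> {p. p permutes {..<Suc n}}"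
    then have "sign (p \<circ> lift_perm q) = sign p * sign q"
      using lift_perm_permutes_sign[of q n] sign_compose_permutes[of p "Suc n" "lift_perm q" "Suc n"]
      by (metis mem_Collect_eq)
    then show "of_int (sign p) * \<alpha> z (\<lambda>_. h (p 0)) * (of_int (sign q) * (\<Prod>i<n. c i (h (p (Suc (q i))))))
        = ?A (p \<circ> lift_perm q)"
      by (simp add: lift_perm_def)
  qed
  also have "\<dots> = (\<Sum>q | q permutes {..<n}. \<Sum>p | p permutes {..<Suc n}. ?A p)"
  proof (rule sum.cong[OF refl])
    fix q assume "q \<in> {q. q permutes {..<n}}"
    then have "lift_perm q permutes {..<Suc n}" using lift_perm_permutes_sign by auto
    then show "(\<Sum>p | p permutes {..<Suc n}. ?A (p \<circ> lift_perm q)) = (\<Sum>p | p permutes {..<Suc n}. ?A p)"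
      by (rule sum_permutations_compose_right[symmetric])
  qed
  also have "\<dots> = fact n * alt_prod (Suc n) (case_nat (\<lambda>x. \<alpha> z (\<lambda>_. x)) c) h"
    by (simp add: alt card_permutations[OF card_lessThan])
  finally show ?thesis by simp
qed

lemma wedge_one_forms_alt_prod:
  assumes "\<And>\<gamma> h h'. \<gamma> \<in> set \<gamma>s \<Longrightarrow> h 0 = h' 0 \<Longrightarrow> \<gamma> z h = \<gamma> z h'"
  shows "wedge_one_forms \<gamma>s z h = alt_prod (length \<gamma>s) (\<lambda>i x. (\<gamma>s ! i) z (\<lambda>_. x)) h"
  using assms
proof (induction \<gamma>s arbitrary: h)
  case Nil
  show ?case by (simp add: alt_prod_def)
next
  case (Cons \<gamma> \<gamma>s)
  have eq: "case_nat (\<lambda>x. \<gamma> z (\<lambda>_. x)) (\<lambda>i x. (\<gamma>s ! i) z (\<lambda>_. x))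
      = (\<lambda>i x. ((\<gamma> # \<gamma>s) ! i) z (\<lambda>_. x))"
    by (auto simp: fun_eq_iff split: nat.splits)
  have \<gamma>: "\<gamma> z h = \<gamma> z h'" if "h 0 = h' 0" for h h'
    using that by (intro Cons.prems) simp_all
  have "wedge_one_forms \<gamma>s z h = alt_prod (length \<gamma>s) (\<lambda>i x. (\<gamma>s ! i) z (\<lambda>_. x)) h" for h
    using Cons.prems by (intro Cons.IH) (simp only: list.set_intros)
  from wedge_alt_prod[of \<gamma> z "wedge_one_forms \<gamma>s", OF \<gamma> this]
  have "wedge 1 (length \<gamma>s) \<gamma> (wedge_one_forms \<gamma>s) z h
      = alt_prod (Suc (length \<gamma>s)) (case_nat (\<lambda>x. \<gamma> z (\<lambda>_. x)) (\<lambda>i x. (\<gamma>s ! i) z (\<lambda>_. x))) h"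
    by blast
  then show ?case
    unfolding eq by simp
qed

lemma alt_prod_cong:
  assumes "\<And>i x. i < n \<Longrightarrow> c i x = d i x"
  shows "alt_prod n c h = alt_prod n d h"
  unfolding alt_prod_def by (intro sum.cong refl arg_cong2[where f = "(*)"] prod.cong) (auto simp: assms)

lemma prod_fun_upd_permutes:
  fixes c :: "nat \<Rightarrow> 'v \<Rightarrow> complex"
  assumes p: "p permutes {..<n}" and i: "i < n"
  shows "(\<Prod>l<n. c l ((h(i := x)) (p l)))
       = c (inv p i) x * (\<Prod>l\<in>{..<n} - {inv p i}. c l (h (p l)))"
proof -
  have l: "inv p i \<in> {..<n}" using permutes_in_image[OF permutes_inv[OF p], of i] i by simp
  have "(\<Prod>l\<in>{..<n} - {inv p i}. c l ((h(i := x)) (p l))) = (\<Prod>l\<in>{..<n} - {inv p i}. c l (h (p l)))"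
  proof (intro prod.cong refl)
    fix l assume "l \<in> {..<n} - {inv p i}"
    then have "p l \<noteq> i" using permutes_inverses(2)[OF p, of l] by auto
    then show "c l ((h(i := x)) (p l)) = c l (h (p l))" by simp
  qed
  then show ?thesis
    using l permutes_inverses(1)[OF p] by (subst prod.remove[OF _ l]) auto
qed

lemma alternating_form_alt_prod:
  assumes c: "\<And>i. i < n \<Longrightarrow> linear (c i)"
  shows "alternating_form n (alt_prod n c)"
  unfolding alternating_form_def
proof (intro conjI allI impI)
  fix h h' :: "nat \<Rightarrow> 'a" assume "\<forall>i<n. h i = h' i"
  then show "alt_prod n c h = alt_prod n c h'"
    unfolding alt_prod_def
    by (intro sum.cong refl arg_cong2[where f = "(*)"] prod.cong)
       (metis lessThan_iff mem_Collect_eq permutes_in_image)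
next
  fix h :: "nat \<Rightarrow> 'a" and i assume i: "i < n"
  have lin: "linear (\<lambda>x. a * (c (inv p i) x * b))" if p: "p permutes {..<n}" for p a b
  proof -
    have "linear (c (inv p i))"
      using c permutes_in_image[OF permutes_inv[OF p], of i] i by simp
    then show ?thesis
      by (intro linearI) (simp_all add: linear_add linear_scale algebra_simps scaleR_conv_of_real)
  qed
  have "linear (\<lambda>x. \<Sum>p | p permutes {..<n}. of_int (sign p) *
      (c (inv p i) x * (\<Prod>l\<in>{..<n} - {inv p i}. c l (h (p l)))))"
    by (rule linear_compose_sum) (use lin in blast)
  moreover have "alt_prod n c (h(i := x)) = (\<Sum>p | p permutes {..<n}. of_int (sign p) *
      (c (inv p i) x * (\<Prod>l\<in>{..<n} - {inv p i}. c l (h (p l)))))" for x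
    unfolding alt_prod_def
    by (intro sum.cong refl arg_cong2[where f = "(*)"] prod_fun_upd_permutes i) simp
  ultimately show "linear (\<lambda>x. alt_prod n c (h(i := x)))"
    by (simp only:)
next
  fix h :: "nat \<Rightarrow> 'a" and i j
  assume "i < n" "j < n" and ij: "i \<noteq> j \<and> h i = h j"
  then show "alt_prod n c h = 0"
    unfolding alt_prod_def
    by (intro signed_sum_eq_0_left[of i n j]) (auto simp: Transposition.transpose_def intro!: prod.cong)
qed

lemma alternating_form_sum:
  fixes \<eta> :: "'i \<Rightarrow> (nat \<Rightarrow> 'a::real_vector) \<Rightarrow> complex"
  assumes "\<And>i. i \<in> I \<Longrightarrow> alternating_form m (\<eta> i)"
  shows "alternating_form m (\<lambda>h. \<Sum>i\<in>I. a i * \<eta> i h)"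
  unfolding alternating_form_def
proof (intro conjI allI impI)
  fix h h' :: "nat \<Rightarrow> 'a" assume "\<forall>i<m. h i = h' i"
  then have "\<eta> i h = \<eta> i h'" if "i \<in> I" for i
    using assms[OF that] by (simp add: alternating_form_def)
  then show "(\<Sum>i\<in>I. a i * \<eta> i h) = (\<Sum>i\<in>I. a i * \<eta> i h')"
    by simp
next
  fix h :: "nat \<Rightarrow> 'a" and j assume "j < m"
  then have "linear (\<lambda>x. \<eta> i (h(j := x)))" if "i \<in> I" for i
    using assms[OF that] by (simp add: alternating_form_def)
  then have "linear (\<lambda>x. a i * \<eta> i (h(j := x)))" if "i \<in> I" for i
    using linear_compose[OF _ linear_times, of "\<lambda>x. \<eta> i (h(j := x))" "a i"] that
    by (simp add: o_def)
  then show "linear (\<lambda>x. \<Sum>i\<in>I. a i * \<eta> i (h(j := x)))"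
    by (intro linear_compose_sum) auto
next
  fix h :: "nat \<Rightarrow> 'a" and i j assume "i < m" "j < m" "i \<noteq> j \<and> h i = h j"
  then have "\<eta> l h = 0" if "l \<in> I" for l
    using assms[OF that] by (simp add: alternating_form_def)
  then show "(\<Sum>i\<in>I. a i * \<eta> i h) = 0"
    by simp
qed

section \<open>The projection onto forms of type (0,q)\<close>

lemma type_proj_0:
  "type_proj 0 q \<omega> z h
     = (\<Sum>T\<in>Pow {..<q}. \<i> ^ card T * \<omega> z (\<lambda>i. if i \<in> T then \<i> *s h i else h i)) / 2 ^ q"
proof -
  have "{S. S \<subseteq> {..<0 + q} \<and> card S = 0} = {{}}"
    by (auto dest: finite_subset)
  then show ?thesis
    unfolding type_proj_def by (simp add: prod_constant)
qed

text \<open>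
  The conjugate-linear part of a real-linear map.
\<close>

definition antiholo :: "(complex ^ 'n \<Rightarrow> complex) \<Rightarrow> complex ^ 'n \<Rightarrow> complex" where
  "antiholo f x = (f x + \<i> * f (\<i> *s x)) / 2"

text \<open>
  The sum over the sets \<open>T\<close> of arguments is the expansion of the product of the binomials
  \<open>c\<^sub>i (h) + \<i> c\<^sub>i (\<i> h)\<close>.
\<close>

lemma type_proj_alt_prod:
  assumes "\<And>h. \<omega> z h = alt_prod n c h"
  shows "type_proj 0 n \<omega> z h = alt_prod n (\<lambda>i. antiholo (c i)) h"
proof -
  have "(\<Sum>T\<in>Pow {..<n}. \<i> ^ card T * (\<Prod>i<n. c i (if p i \<in> T then \<i> *s h (p i) else h (p i))))
      = 2 ^ n * (\<Prod>i<n. antiholo (c i) (h (p i)))" if p: "p permutes {..<n}" for p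
  proof -
    have two: "2 * antiholo f x = \<i> * f (\<i> *s x) + f x" for f :: "complex ^ 'a \<Rightarrow> complex" and x
      by (simp add: antiholo_def)
    have re: "(\<Prod>i<n. f i (p i)) = (\<Prod>j<n. f (inv p j) j)" for f :: "nat \<Rightarrow> nat \<Rightarrow> complex"
      by (subst prod.permute[OF p]) (simp add: permutes_inverses(2)[OF p])
    have "(\<Sum>T\<in>Pow {..<n}. \<i> ^ card T * (\<Prod>i<n. c i (if p i \<in> T then \<i> *s h (p i) else h (p i))))
      = (\<Sum>T\<in>Pow {..<n}. (\<Prod>j\<in>T. \<i> * c (inv p j) (\<i> *s h j)) * (\<Prod>j\<in>{..<n} - T. c (inv p j) (h j)))"
    proof (intro sum.cong refl)
      fix T assume "T \<in> Pow {..<n}"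
      then have T: "T \<subseteq> {..<n}" by simp
      have "(\<Prod>i<n. c i (if p i \<in> T then \<i> *s h (p i) else h (p i)))
          = (\<Prod>j<n. c (inv p j) (if j \<in> T then \<i> *s h j else h j))"
        by (rule re)
      also have "\<dots> = (\<Prod>j\<in>{..<n} - T. c (inv p j) (h j)) * (\<Prod>j\<in>T. c (inv p j) (\<i> *s h j))"
        by (subst prod.subset_diff[OF T]) auto
      finally show "\<i> ^ card T * (\<Prod>i<n. c i (if p i \<in> T then \<i> *s h (p i) else h (p i)))
         = (\<Prod>j\<in>T. \<i> * c (inv p j) (\<i> *s h j)) * (\<Prod>j\<in>{..<n} - T. c (inv p j) (h j))"
        by (simp add: prod.distrib prod_constant)
    qed
    also have "\<dots> = (\<Prod>j<n. \<i> * c (inv p j) (\<i> *s h j) + c (inv p j) (h j))"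
      by (rule prod_add[symmetric]) simp
    also have "\<dots> = (\<Prod>i<n. 2 * antiholo (c i) (h (p i)))"
      unfolding two by (rule re[of "\<lambda>i j. \<i> * c i (\<i> *s h j) + c i (h j)", symmetric])
    finally show ?thesis by (simp add: prod.distrib)
  qed
  then have "(\<Sum>p | p permutes {..<n}. of_int (sign p) * (\<Sum>T\<in>Pow {..<n}. \<i> ^ card T *
        (\<Prod>i<n. c i (if p i \<in> T then \<i> *s h (p i) else h (p i)))))
      = 2 ^ n * alt_prod n (\<lambda>i. antiholo (c i)) h"
    unfolding alt_prod_def sum_distrib_left[of "2 ^ n"]
    by (intro sum.cong) (simp_all only: mem_Collect_eq mult.left_commute)
  moreover have "(\<Sum>p | p permutes {..<n}. of_int (sign p) * (\<Sum>T\<in>Pow {..<n}. \<i> ^ card T *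
        (\<Prod>i<n. c i (if p i \<in> T then \<i> *s h (p i) else h (p i)))))
      = (\<Sum>T\<in>Pow {..<n}. \<i> ^ card T * \<omega> z (\<lambda>i. if i \<in> T then \<i> *s h i else h i))"
    unfolding assms alt_prod_def sum_distrib_left
    by (subst sum.swap) (simp only: mult.left_commute)
  ultimately show ?thesis by (simp add: type_proj_0)
qed

lemma antilinear_scale_subset:
  assumes T: "finite T" "T \<subseteq> A"
    and F: "\<And>h j. j \<in> A \<Longrightarrow> F (h(j := \<i> *s h j)) = - \<i> * F h"
  shows "\<i> ^ card T * F (\<lambda>i. if i \<in> T then \<i> *s h i else h i) = (F h :: complex)"
  using T
proof (induction T rule: finite_induct)
  case (insert j T)
  let ?h = "\<lambda>i. if i \<in> T then \<i> *s h i else h i"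
  have "(\<lambda>i. if i \<in> insert j T then \<i> *s h i else h i) = ?h(j := \<i> *s ?h j)"
    using insert.hyps by auto
  moreover have "F (?h(j := \<i> *s ?h j)) = - \<i> * F ?h"
    using insert.prems by (intro F) auto
  ultimately have "F (\<lambda>i. if i \<in> insert j T then \<i> *s h i else h i) = - \<i> * F ?h"
    by simp
  moreover have "\<i> * a * (- \<i> * b) = a * b" for a b :: complex
    by (simp add: complex_eq_iff)
  moreover have "\<i> ^ card (insert j T) = \<i> * \<i> ^ card T"
    using insert.hyps by simp
  ultimately have "\<i> ^ card (insert j T) * F (\<lambda>i. if i \<in> insert j T then \<i> *s h i else h i)
      = \<i> ^ card T * F ?h"
    by (simp only:)
  also have "\<dots> = F h" using insert by simp
  finally show ?case .
qed simp

text \<open>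
  If a form is already conjugate-linear in all arguments but the one with index \<open>k\<close>, then the projection
  to type (0,n) only acts on this argument. The left-hand side is the formula of \<open>type_proj_0\<close>. By
  conjugate-linearity, a factor \<open>\<i>\<close> in front of another argument contributes \<open>- \<i>\<close>, which the
  factor \<open>\<i>\<close> in front of the summand compensates.
\<close>

lemma type_proj_antilinear_except:
  assumes k: "k < n"
    and F: "\<And>h j. j < n \<Longrightarrow> j \<noteq> k \<Longrightarrow> F (h(j := \<i> *s h j)) = - \<i> * F h"
  shows "(\<Sum>T\<in>Pow {..<n}. \<i> ^ card T * F (\<lambda>i. if i \<in> T then \<i> *s h i else h i)) / 2 ^ n
       = (F h + \<i> * F (h(k := \<i> *s h k))) / (2 :: complex)"
proof -
  let ?A = "{..<n} - {k}"
  let ?g = "\<lambda>T. \<i> ^ card T * F (\<lambda>i. if i \<in> T then \<i> *s h i else h i)"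
  have *: "\<i> ^ card T * F (\<lambda>i. if i \<in> T then \<i> *s g i else g i) = F g" if "T \<subseteq> ?A" for T g
    using that by (intro antilinear_scale_subset[of T ?A] F) (auto dest: finite_subset)
  have ins: "{..<n} = insert k ?A" using k by auto
  have "(\<Sum>T\<in>Pow {..<n}. ?g T) = (\<Sum>T\<in>Pow ?A. ?g T) + (\<Sum>T\<in>Pow ?A. ?g (insert k T))"
  proof -
    have inj: "inj_on (insert k) (Pow ?A)" by (auto simp: inj_on_def)
    have "(\<Sum>T\<in>Pow {..<n}. ?g T) = (\<Sum>T\<in>Pow ?A \<union> insert k ` Pow ?A. ?g T)"
      by (subst ins) (simp only: Pow_insert)
    also have "\<dots> = (\<Sum>T\<in>Pow ?A. ?g T) + (\<Sum>T\<in>insert k ` Pow ?A. ?g T)"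
      by (rule sum.union_disjoint) auto
    also have "(\<Sum>T\<in>insert k ` Pow ?A. ?g T) = (\<Sum>T\<in>Pow ?A. ?g (insert k T))"
      by (subst sum.reindex[OF inj]) simp
    finally show ?thesis .
  qed
  also have "(\<Sum>T\<in>Pow ?A. ?g T) = 2 ^ (n - 1) * F h"
    using * k by (simp add: card_Pow)
  also have "(\<Sum>T\<in>Pow ?A. ?g (insert k T)) = (\<Sum>T\<in>Pow ?A. \<i> * F (h(k := \<i> *s h k)))"
  proof (intro sum.cong refl)
    fix T assume T: "T \<in> Pow ?A"
    then have k: "k \<notin> T" by auto
    let ?h = "h(k := \<i> *s h k)"
    have "(\<lambda>i. if i \<in> insert k T then \<i> *s h i else h i) = (\<lambda>i. if i \<in> T then \<i> *s ?h i else ?h i)"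
      using k by (auto simp: fun_eq_iff)
    moreover have "card (insert k T) = Suc (card T)"
      using T by (auto intro!: card_insert_disjoint dest: finite_subset)
    ultimately show "?g (insert k T) = \<i> * F ?h"
      using *[of T ?h] T by simp
  qed
  also have "\<dots> = 2 ^ (n - 1) * (\<i> * F (h(k := \<i> *s h k)))"
    using k by (simp add: card_Pow)
  finally have "(\<Sum>T\<in>Pow {..<n}. ?g T) = 2 ^ (n - 1) * (F h + \<i> * F (h(k := \<i> *s h k)))"
    by (simp add: algebra_simps)
  moreover have "(2 :: complex) ^ n = 2 ^ (n - 1) * 2"
    using k by (cases n) auto
  ultimately show ?thesis by simp
qed

lemma type_proj_sum:
  assumes "\<And>h. \<omega> z h = (\<Sum>i\<in>I. a i * \<omega>' i z h)"
  shows "type_proj p q \<omega> z h = (\<Sum>i\<in>I. a i * type_proj p q (\<omega>' i) z h)"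
proof -
  have *: "(\<Sum>S | S \<subseteq> {..<p + q} \<and> card S = p. \<Sum>T\<in>Pow {..<p + q}. t S T * (\<Sum>i\<in>I. a i * u T i))
     = (\<Sum>i\<in>I. a i * (\<Sum>S | S \<subseteq> {..<p + q} \<and> card S = p. \<Sum>T\<in>Pow {..<p + q}. t S T * u T i))"
    for t :: "nat set \<Rightarrow> nat set \<Rightarrow> complex" and u
    by (simp only: sum_distrib_left sum.swap[of _ I] mult.left_commute)
  show ?thesis
    unfolding type_proj_def assms * sum_divide_distrib[where A = I] times_divide_eq_right ..
qed

lemma alt_prod_antilinear:
  assumes c: "\<And>i x. i < n \<Longrightarrow> c i (\<i> *s x) = - \<i> * c i x" and j: "j < n"
  shows "alt_prod n c (h(j := \<i> *s h j)) = - \<i> * alt_prod n c h"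
  unfolding alt_prod_def sum_distrib_left
proof (rule sum.cong[OF refl])
  fix p assume "p \<in> {p. p permutes {..<n}}"
  then have p: "p permutes {..<n}" by simp
  have "inv p j < n" using permutes_in_image[OF permutes_inv[OF p], of j] j by simp
  then have "(\<Prod>i<n. c i ((h(j := \<i> *s h j)) (p i))) = - \<i> * (\<Prod>i<n. c i ((h(j := h j)) (p i)))"
    unfolding prod_fun_upd_permutes[OF p j] by (simp add: c)
  then show "of_int (sign p) * (\<Prod>i<n. c i ((h(j := \<i> *s h j)) (p i)))
      = - \<i> * (of_int (sign p) * (\<Prod>i<n. c i (h (p i))))"
    by (simp only: fun_upd_triv mult.left_commute)
qed

section \<open>Smooth functions\<close>

text \<open>
  The definition of \<open>Ck_on\<close> is recursive in the derivative along constant directions. Closure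
  under products and inverses follows by induction on the order. In the product rule, this monotonicity
  supplies the regularity of the undifferentiated factors.
\<close>

lemma Ck_on_Suc_imp: "Ck_on (Suc k) S f \<Longrightarrow> Ck_on k S f"
proof (induction k arbitrary: f)
  case 0
  then show ?case by (simp add: differentiable_imp_continuous_on)
next
  case (Suc k)
  then show ?case by (metis Ck_on.simps(2))
qed

lemma Ck_on_cong:
  assumes "open S" "\<And>x. x \<in> S \<Longrightarrow> f x = g x" "Ck_on k S f"
  shows "Ck_on k S g"
  using assms(2,3)
proof (induction k arbitrary: f g)
  case 0
  then show ?case using continuous_on_cong[of S S f g] by simp
next
  case (Suc k)
  have f: "f differentiable (at x)" if "x \<in> S" for x
    using Suc.prems(2) that by (simp add: differentiable_on_eq_differentiable_at[OF assms(1)])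
  have eq: "frechet_derivative f (at x) = frechet_derivative g (at x)" if "x \<in> S" for x
    by (rule frechet_derivative_transform_within_open[OF f[OF that] assms(1) that Suc.prems(1)])
  have "Ck_on k S (\<lambda>x. frechet_derivative g (at x) h)" for h
  proof (rule Suc.IH)
    show "Ck_on k S (\<lambda>x. frechet_derivative f (at x) h)" using Suc.prems(2) by simp
    show "frechet_derivative f (at x) h = frechet_derivative g (at x) h" if "x \<in> S" for x
      by (simp only: eq[OF that])
  qed
  moreover have "g differentiable_on S"
    unfolding differentiable_on_eq_differentiable_at[OF assms(1)]
  proof
    fix x assume x: "x \<in> S"
    from f[OF x] obtain f' where "(f has_derivative f') (at x)"
      by (auto simp: differentiable_def)
    then have "(g has_derivative f') (at x)"
      by (rule has_derivative_transform_within_open[OF _ assms(1) x]) (use Suc.prems in auto)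
    then show "g differentiable (at x)" by (auto simp: differentiable_def)
  qed
  ultimately show ?case by simp
qed

lemma Ck_on_Suc_I:
  assumes S: "open S"
    and f: "\<And>x. x \<in> S \<Longrightarrow> (f has_derivative f' x) (at x)"
    and f': "\<And>h. Ck_on k S (\<lambda>x. f' x h)"
  shows "Ck_on (Suc k) S f"
proof -
  have "Ck_on k S (\<lambda>x. frechet_derivative f (at x) h)" for h
    by (rule Ck_on_cong[OF S _ f']) (simp add: frechet_derivative_at[OF f])
  moreover have "f differentiable_on S"
    unfolding differentiable_on_eq_differentiable_at[OF S] using f by (auto simp: differentiable_def)
  ultimately show ?thesis by simp
qed

lemma Ck_on_Suc_has_derivative:
  assumes "open S" "Ck_on (Suc k) S f" "x \<in> S"
  shows "(f has_derivative frechet_derivative f (at x)) (at x)"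
proof -
  have "f differentiable (at x)"
    using assms by (simp add: differentiable_on_eq_differentiable_at)
  then show ?thesis by (rule frechet_derivative_works[THEN iffD1])
qed

lemma Ck_on_const:
  assumes "open S"
  shows "Ck_on k S (\<lambda>x. c)"
proof (induction k arbitrary: c)
  case (Suc k)
  show ?case by (rule Ck_on_Suc_I[where f' = "\<lambda>_ _. 0"]) (simp_all add: assms Suc)
qed simp

lemma Ck_on_bounded_linear:
  assumes "open S" "bounded_linear f"
  shows "Ck_on k S f"
proof (cases k)
  case 0
  then show ?thesis
    using linear_continuous_on[OF assms(2)] by simp
next
  case (Suc j)
  show ?thesis unfolding Suc
    by (rule Ck_on_Suc_I[where f' = "\<lambda>_. f"])
       (simp_all add: assms bounded_linear_imp_has_derivative Ck_on_const)
qed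

lemma Ck_on_add:
  assumes S: "open S" and "Ck_on k S f" "Ck_on k S g"
  shows "Ck_on k S (\<lambda>x. f x + g x)"
  using assms(2,3)
proof (induction k arbitrary: f g)
  case 0
  then show ?case by (simp add: continuous_on_add)
next
  case (Suc k)
  show ?case
  proof (rule Ck_on_Suc_I[OF S])
    show "((\<lambda>x. f x + g x) has_derivative
        (\<lambda>h. frechet_derivative f (at x) h + frechet_derivative g (at x) h)) (at x)" if "x \<in> S" for x
      by (intro has_derivative_add Ck_on_Suc_has_derivative[OF S Suc.prems(1) that]
          Ck_on_Suc_has_derivative[OF S Suc.prems(2) that])
    show "Ck_on k S (\<lambda>x. frechet_derivative f (at x) h + frechet_derivative g (at x) h)" for h
      using Suc.prems by (intro Suc.IH) simp_all
  qed
qed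

lemma Ck_on_mult:
  assumes S: "open S" and "Ck_on k S f" "Ck_on k S g"
  shows "Ck_on k S (\<lambda>x. f x * g x)"
  using assms(2,3)
proof (induction k arbitrary: f g)
  case 0
  then show ?case by (simp add: continuous_on_mult)
next
  case (Suc k)
  show ?case
  proof (rule Ck_on_Suc_I[OF S])
    show "((\<lambda>x. f x * g x) has_derivative
        (\<lambda>h. f x * frechet_derivative g (at x) h + frechet_derivative f (at x) h * g x)) (at x)"
      if "x \<in> S" for x
      by (intro has_derivative_mult Ck_on_Suc_has_derivative[OF S Suc.prems(1) that]
          Ck_on_Suc_has_derivative[OF S Suc.prems(2) that])
    show "Ck_on k S (\<lambda>x. f x * frechet_derivative g (at x) h + frechet_derivative f (at x) h * g x)" for h
      using Suc.prems Suc.prems[THEN Ck_on_Suc_imp] by (intro Ck_on_add S Suc.IH) simp_all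
  qed
qed

lemma Ck_on_inverse:
  assumes S: "open S" and nz: "\<And>x. x \<in> S \<Longrightarrow> f x \<noteq> 0" and "Ck_on k S f"
  shows "Ck_on k S (\<lambda>x. inverse (f x))"
  using assms(3)
proof (induction k)
  case 0
  then show ?case using nz by (simp add: continuous_on_inverse)
next
  case (Suc k)
  have inv: "Ck_on k S (\<lambda>x. inverse (f x))"
    using Suc Ck_on_Suc_imp by blast
  have "Ck_on k S (\<lambda>x. (-1) * (inverse (f x) * frechet_derivative f (at x) h * inverse (f x)))" for h
    using Suc.prems by (intro Ck_on_mult S inv Ck_on_const) simp
  moreover have "((\<lambda>x. inverse (f x)) has_derivative
      (\<lambda>h. (-1) * (inverse (f x) * frechet_derivative f (at x) h * inverse (f x)))) (at x)"
    if "x \<in> S" for x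
    using Deriv.has_derivative_inverse[OF nz[OF that] Ck_on_Suc_has_derivative[OF S Suc.prems that]] by simp
  ultimately show ?case
    by (intro Ck_on_Suc_I[OF S, of "\<lambda>x. inverse (f x)"
          "\<lambda>x h. (-1) * (inverse (f x) * frechet_derivative f (at x) h * inverse (f x))"])
qed

lemma Ck_on_sum:
  assumes S: "open S" and "\<And>i. i \<in> I \<Longrightarrow> Ck_on k S (f i)"
  shows "Ck_on k S (\<lambda>x. \<Sum>i\<in>I. f i x)"
  using assms(2)
  by (induction I rule: infinite_finite_induct) (simp_all add: Ck_on_add Ck_on_const S)

lemma Ck_on_prod:
  assumes S: "open S" and "\<And>i. i \<in> I \<Longrightarrow> Ck_on k S (f i)"
  shows "Ck_on k S (\<lambda>x. \<Prod>i\<in>I. f i x)"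
  using assms(2)
  by (induction I rule: infinite_finite_induct) (simp_all add: Ck_on_mult Ck_on_const S)

lemma Ck_on_diff:
  assumes S: "open S" and f: "Ck_on k S f" and g: "Ck_on k S g"
  shows "Ck_on k S (\<lambda>x. f x - g x)"
  using Ck_on_add[OF S f Ck_on_mult[OF S Ck_on_const[OF S, of _ "-1"] g]] by simp

section \<open>The forms on projective space in homogeneous coordinates\<close>

text \<open>
  The standard Hermitian form, linear in the first argument. The form \<open>herm z x\<close> in the variable \<open>x\<close> is
  \<open>dbar |z|\<^sup>2\<close>.
\<close>

definition herm :: "complex ^ 'n::finite \<Rightarrow> complex ^ 'n \<Rightarrow> complex" where
  "herm x y = (\<Sum>k\<in>UNIV. x $ k * cnj (y $ k))"

lemma herm_add_left: "herm (x + y) z = herm x z + herm y z"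
  by (simp add: herm_def distrib_right sum.distrib)

lemma herm_add_right: "herm x (y + z) = herm x y + herm x z"
  by (simp add: herm_def distrib_left sum.distrib)

lemma herm_scale_left: "herm (c *s x) y = c * herm x y"
  by (simp add: herm_def sum_distrib_left mult.assoc)

lemma herm_scale_right: "herm x (c *s y) = cnj c * herm x y"
  by (simp add: herm_def sum_distrib_left mult.left_commute)

lemmas herm_simps = herm_add_left herm_add_right herm_scale_left herm_scale_right

lemma scaleR_vec_eq: "r *\<^sub>R (x :: complex ^ 'n) = of_real r *s x"
  unfolding vec_eq_iff vector_scaleR_component vector_smult_component
  by (simp add: scaleR_conv_of_real)

lemma herm_self: "herm z z = of_real ((norm z)\<^sup>2)"
proof -
  have "(norm z)\<^sup>2 = (\<Sum>k\<in>UNIV. (norm (z $ k))\<^sup>2)"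
    by (simp add: norm_vec_def L2_set_def sum_nonneg)
  then show ?thesis
    unfolding herm_def complex_norm_square[symmetric] by simp
qed

lemma herm_self_nonzero: "z \<noteq> 0 \<Longrightarrow> herm z z \<noteq> 0"
  by (simp add: herm_self)

lemma Q_fun_herm: "Q_fun i j z = z $ i * (cnj (z $ j) / herm z z)"
  unfolding Q_fun_def herm_self scaleR_vec_eq
  by (simp add: power2_eq_square divide_simps)

lemma has_derivative_nth: "((\<lambda>z. z $ i) has_derivative (\<lambda>x. x $ i)) (at z)"
  by (rule bounded_linear_imp_has_derivative[OF bounded_linear_vec_nth])

lemma has_derivative_cnj_nth: "((\<lambda>z. cnj (z $ i)) has_derivative (\<lambda>x. cnj (x $ i))) (at z)"
  by (intro has_derivative_cnj has_derivative_nth)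

lemma has_derivative_herm_self:
  "((\<lambda>z. herm z z) has_derivative (\<lambda>x. herm x z + herm z x)) (at z)"
  unfolding herm_def
  by (rule has_derivative_eq_rhs,
      rule has_derivative_sum, rule has_derivative_mult[OF has_derivative_nth has_derivative_cnj_nth])
     (simp add: sum.distrib add.commute fun_eq_iff)

lemma has_derivative_herm_left:
  "((\<lambda>z. herm z x) has_derivative (\<lambda>y. herm y x)) (at z)"
  unfolding herm_def
  by (intro has_derivative_sum has_derivative_mult_left has_derivative_nth)

definition dQ_form :: "'n::finite \<Rightarrow> 'n \<Rightarrow> complex ^ 'n \<Rightarrow> complex ^ 'n \<Rightarrow> complex" where
  "dQ_form i j z x =
     (x $ i * cnj (z $ j) + z $ i * cnj (x $ j)) / herm z z
     - z $ i * cnj (z $ j) * (herm x z + herm z x) / (herm z z)\<^sup>2"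

lemma Q_fun_has_derivative:
  assumes "z \<noteq> 0"
  shows "(Q_fun i j has_derivative dQ_form i j z) (at z)"
proof -
  have "((\<lambda>z. z $ i * cnj (z $ j) / herm z z) has_derivative dQ_form i j z) (at z)"
    by (rule has_derivative_eq_rhs,
        rule has_derivative_divide[OF has_derivative_mult[OF has_derivative_nth has_derivative_cnj_nth]
            has_derivative_herm_self herm_self_nonzero[OF assms]])
       (use herm_self_nonzero[OF assms] in
        \<open>simp add: fun_eq_iff dQ_form_def field_simps power2_eq_square\<close>)
  then show ?thesis by (simp add: Q_fun_herm[abs_def])
qed

lemma dQ_frechet: "dQ i j z h = frechet_derivative (Q_fun i j) (at z) (h 0)"
  by (simp add: dQ_def ext_d_def)

lemma dQ_eq: "z \<noteq> 0 \<Longrightarrow> dQ i j z h = dQ_form i j z (h 0)"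
  by (simp add: dQ_frechet frechet_derivative_at[OF Q_fun_has_derivative, symmetric])

text \<open>
  The function \<open>u\<^sub>b = cnj z\<^sub>b / |z|\<^sup>2\<close> satisfies \<open>Q\<^sub>a\<^sub>b = z\<^sub>a u\<^sub>b\<close>. The forms \<open>dbar u\<^sub>b\<close>, \<open>dbar Q\<^sub>a\<^sub>b\<close>
  and \<open>del Q\<^sub>a\<^sub>b\<close> below are given by their values at the point \<open>z\<close> on the tangent vector \<open>x\<close>.
\<close>

definition dbar_u :: "'n::finite \<Rightarrow> complex ^ 'n \<Rightarrow> complex ^ 'n \<Rightarrow> complex" where
  "dbar_u b z x = cnj (x $ b) / herm z z - cnj (z $ b) * herm z x / (herm z z)\<^sup>2"

definition dbar_Q :: "'n::finite \<Rightarrow> 'n \<Rightarrow> complex ^ 'n \<Rightarrow> complex ^ 'n \<Rightarrow> complex" where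
  "dbar_Q a b z x = z $ a * dbar_u b z x"

definition del_Q :: "'n::finite \<Rightarrow> 'n \<Rightarrow> complex ^ 'n \<Rightarrow> complex ^ 'n \<Rightarrow> complex" where
  "del_Q a b z x = cnj (z $ b) * (x $ a / herm z z - z $ a * herm x z / (herm z z)\<^sup>2)"

lemma dQ_form_split: "dQ_form i j z x = del_Q i j z x + dbar_Q i j z x"
  by (simp add: dQ_form_def del_Q_def dbar_Q_def dbar_u_def algebra_simps add_divide_distrib)

lemma sum_nth_u: "z \<noteq> 0 \<Longrightarrow> (\<Sum>a\<in>UNIV. z $ a * (cnj (z $ a) / herm z z)) = 1"
  using herm_self_nonzero[of z] by (simp add: herm_def flip: sum_divide_distrib)

text \<open>
  Apply \<open>dbar\<close> to \<open>\<Sum> z\<^sub>a u\<^sub>a = 1\<close>, with \<open>z\<^sub>a\<close> holomorphic.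
\<close>

lemma sum_nth_dbar_u:
  assumes "z \<noteq> 0"
  shows "(\<Sum>a\<in>UNIV. z $ a * dbar_u a z x) = 0"
proof -
  have "(\<Sum>a\<in>UNIV. z $ a * dbar_u a z x)
      = (\<Sum>a\<in>UNIV. z $ a * cnj (x $ a)) / herm z z
        - (\<Sum>a\<in>UNIV. z $ a * cnj (z $ a)) * (herm z x / (herm z z)\<^sup>2)"
    by (simp add: dbar_u_def right_diff_distrib sum_subtractf sum_divide_distrib
        sum_distrib_right mult.assoc)
  also have "\<dots> = 0"
    using herm_self_nonzero[OF assms] by (simp add: power2_eq_square flip: herm_def)
  finally show ?thesis .
qed

lemma sum_Q_fun: "z \<noteq> 0 \<Longrightarrow> (\<Sum>c\<in>UNIV. Q_fun c c z) = 1"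
  unfolding Q_fun_herm by (rule sum_nth_u)

lemma sum_dbar_Q: "z \<noteq> 0 \<Longrightarrow> (\<Sum>c\<in>UNIV. dbar_Q c c z x) = 0"
  unfolding dbar_Q_def by (rule sum_nth_dbar_u)

lemma sum_cnj_del_Q:
  assumes "z \<noteq> 0"
  shows "(\<Sum>k\<in>UNIV. cnj (z $ k) * del_Q k s z x) = 0"
proof -
  have "(\<Sum>k\<in>UNIV. cnj (z $ k) * del_Q k s z x)
      = cnj (z $ s) * ((\<Sum>k\<in>UNIV. x $ k * cnj (z $ k)) / herm z z
        - (\<Sum>k\<in>UNIV. z $ k * cnj (z $ k)) * (herm x z / (herm z z)\<^sup>2))"
    by (simp add: del_Q_def right_diff_distrib sum_subtractf sum_divide_distrib
        sum_distrib_right sum_distrib_left algebra_simps)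
  also have "\<dots> = 0"
    using herm_self_nonzero[OF assms] by (simp add: power2_eq_square flip: herm_def)
  finally show ?thesis .
qed

lemma sum_Q_dbar_Q:
  assumes "z \<noteq> 0"
  shows "(\<Sum>k\<in>UNIV. Q_fun q k z * dbar_Q k s z x) = dbar_Q q s z x"
proof -
  have "(\<Sum>k\<in>UNIV. Q_fun q k z * dbar_Q k s z x)
     = (\<Sum>k\<in>UNIV. z $ k * (cnj (z $ k) / herm z z)) * dbar_Q q s z x"
    unfolding sum_distrib_right by (simp add: Q_fun_herm dbar_Q_def mult_ac)
  then show ?thesis by (simp only: sum_nth_u[OF assms] mult_1)
qed

text \<open>
  In \<open>\<Sum> Q\<^sub>q\<^sub>k dQ\<^sub>k\<^sub>s\<close> the (1,0)-part of \<open>dQ\<close> cancels, and \<open>dbar Q\<^sub>k\<^sub>s = z\<^sub>k dbar u\<^sub>s\<close> contracts with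
  \<open>Q\<^sub>q\<^sub>k = z\<^sub>q u\<^sub>k\<close> to \<open>z\<^sub>q dbar u\<^sub>s\<close>. For \<open>vbar_dv\<close> the types are exchanged.
\<close>

lemma v_dvbar_eq:
  assumes "z \<noteq> 0"
  shows "v_dvbar q s z h = dbar_Q q s z (h 0)"
proof -
  have "(\<Sum>k\<in>UNIV. Q_fun q k z * del_Q k s z (h 0))
     = z $ q / herm z z * (\<Sum>k\<in>UNIV. cnj (z $ k) * del_Q k s z (h 0))"
    by (simp add: Q_fun_herm sum_distrib_left mult_ac)
  also have "\<dots> = 0" by (simp only: sum_cnj_del_Q[OF assms] mult_zero_right)
  finally show ?thesis
    by (simp add: v_dvbar_def dQ_eq assms dQ_form_split distrib_left sum.distrib sum_Q_dbar_Q)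
qed

lemma vbar_dv_eq:
  assumes "z \<noteq> 0"
  shows "vbar_dv p r z h = del_Q r p z (h 0)"
proof -
  have "(\<Sum>k\<in>UNIV. dbar_Q r k z (h 0) * Q_fun k p z)
     = z $ r * cnj (z $ p) / herm z z * (\<Sum>k\<in>UNIV. z $ k * dbar_u k z (h 0))"
    unfolding sum_distrib_left by (simp add: Q_fun_herm dbar_Q_def mult_ac)
  also have "\<dots> = 0" by (simp only: sum_nth_dbar_u[OF assms] mult_zero_right)
  finally have 1: "(\<Sum>k\<in>UNIV. dbar_Q r k z (h 0) * Q_fun k p z) = 0" .
  have "(\<Sum>k\<in>UNIV. del_Q r k z (h 0) * Q_fun k p z)
     = (\<Sum>k\<in>UNIV. z $ k * (cnj (z $ k) / herm z z)) * del_Q r p z (h 0)"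
    unfolding sum_distrib_right by (simp add: Q_fun_herm del_Q_def mult_ac)
  then have 2: "(\<Sum>k\<in>UNIV. del_Q r k z (h 0) * Q_fun k p z) = del_Q r p z (h 0)"
    by (simp only: sum_nth_u[OF assms] mult_1)
  show ?thesis
    by (simp add: vbar_dv_def dQ_eq assms dQ_form_split distrib_right sum.distrib 1 2)
qed

lemma Gam_eq:
  assumes "z \<noteq> 0"
  shows "Gam p q r s z h = (if p = r then dbar_Q q s z (h 0) else 0)
     - Q_fun q s z * dbar_Q r p z (h 0) + Q_fun q s z * del_Q r p z (h 0)"
  by (simp add: Gam_def v_dvbar_eq vbar_dv_eq assms)

lemma Gam_cong: "h 0 = h' 0 \<Longrightarrow> Gam p q r s z h = Gam p q r s z h'"
  by (simp add: Gam_def v_dvbar_def vbar_dv_def dQ_frechet)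

lemma dbar_Q_scale: "dbar_Q a b z (c *s x) = cnj c * dbar_Q a b z x"
  by (simp add: dbar_Q_def dbar_u_def herm_simps algebra_simps)

lemma del_Q_scale: "del_Q a b z (c *s x) = c * del_Q a b z x"
  by (simp add: del_Q_def herm_simps algebra_simps)

lemma linear_dbar_Q: "linear (dbar_Q a b z)"
proof (rule linearI)
  show "dbar_Q a b z (x + y) = dbar_Q a b z x + dbar_Q a b z y" for x y
    by (simp add: dbar_Q_def dbar_u_def herm_simps algebra_simps add_divide_distrib)
  show "dbar_Q a b z (r *\<^sub>R x) = r *\<^sub>R dbar_Q a b z x" for r x
    unfolding scaleR_vec_eq dbar_Q_scale by (simp add: scaleR_conv_of_real)
qed

lemma linear_del_Q: "linear (del_Q a b z)"
proof (rule linearI)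
  show "del_Q a b z (x + y) = del_Q a b z x + del_Q a b z y" for x y
    by (simp add: del_Q_def herm_simps algebra_simps add_divide_distrib)
  show "del_Q a b z (r *\<^sub>R x) = r *\<^sub>R del_Q a b z x" for r x
    unfolding scaleR_vec_eq del_Q_scale by (simp add: scaleR_conv_of_real)
qed

text \<open>
  With the factorisation of \<open>Q\<close> and \<open>dbar Q\<close> the right-hand side is \<open>z\<^sub>q\<close> times a form without the
  index \<open>q\<close>. This is what makes the chain of these forms collapse.
\<close>

lemma antiholo_Gam:
  assumes "z \<noteq> 0"
  shows "antiholo (\<lambda>x. Gam p q r s z (\<lambda>_. x)) x
     = (if p = r then dbar_Q q s z x else 0) - Q_fun q s z * dbar_Q r p z x"
  by (simp add: antiholo_def Gam_eq[OF assms] dbar_Q_scale del_Q_scale field_simps)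

lemma antiholo_dQ: "antiholo (dQ_form i j z) x = dbar_Q i j z x"
  by (simp add: antiholo_def dQ_form_split dbar_Q_scale del_Q_scale algebra_simps)

lemma linear_Gam:
  assumes "z \<noteq> 0"
  shows "linear (\<lambda>x. Gam p q r s z (\<lambda>_. x))"
  by (rule linearI)
     (simp_all add: Gam_eq[OF assms] linear_add[OF linear_dbar_Q] linear_add[OF linear_del_Q]
       linear_scale[OF linear_dbar_Q] linear_scale[OF linear_del_Q] algebra_simps
       scaleR_conv_of_real[where 'a = complex])

text \<open>
  This and the next lemma say that the forms descend to projective space. The extra multiple of \<open>z\<close> is a
  tangent vector of the fibre.
\<close>

lemma dbar_Q_invariant:
  assumes "z \<noteq> 0" "c \<noteq> 0"
  shows "dbar_Q i j (c *s z) (c *s x + a *s z) = dbar_Q i j z x"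
  using herm_self_nonzero[OF assms(1)] assms(2)
  by (simp add: dbar_Q_def dbar_u_def herm_simps field_simps power2_eq_square)

lemma del_Q_invariant:
  assumes "z \<noteq> 0" "c \<noteq> 0"
  shows "del_Q i j (c *s z) (c *s x + a *s z) = del_Q i j z x"
  using herm_self_nonzero[OF assms(1)] assms(2)
  by (simp add: del_Q_def herm_simps field_simps power2_eq_square)

lemma Q_fun_invariant:
  assumes "z \<noteq> 0" "c \<noteq> 0"
  shows "Q_fun i j (c *s z) = Q_fun i j z"
  using herm_self_nonzero[OF assms(1)] assms(2)
  by (simp add: Q_fun_herm herm_simps field_simps)

lemma Gam_invariant:
  assumes "z \<noteq> 0" "c \<noteq> 0"
  shows "Gam p q r s (c *s z) (\<lambda>_. c *s x + a *s z) = Gam p q r s z (\<lambda>_. x)"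
  using assms by (simp add: Gam_eq dbar_Q_invariant del_Q_invariant Q_fun_invariant)

lemma Ck_on_nth: "Ck_on k (- {0}) (\<lambda>z :: complex ^ 'n::finite. z $ i)"
  by (rule Ck_on_bounded_linear) (auto intro: bounded_linear_vec_nth)

lemma Ck_on_cnj_nth: "Ck_on k (- {0}) (\<lambda>z :: complex ^ 'n::finite. cnj (z $ i))"
  by (rule Ck_on_bounded_linear)
     (auto intro: bounded_linear_compose[OF bounded_linear_cnj bounded_linear_vec_nth])

lemma open_minus_0: "open (- {0 :: complex ^ 'n::finite})"
  by (intro open_Compl closed_singleton)

lemma Ck_on_Q_fun: "Ck_on k (- {0}) (Q_fun i j :: complex ^ 'n::finite \<Rightarrow> complex)"
proof -
  note o = open_minus_0
  have "Ck_on k (- {0 :: complex ^ 'n}) (\<lambda>z. z $ i * (cnj (z $ j) * inverse (herm z z)))"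
    unfolding herm_def
    by (intro Ck_on_mult Ck_on_inverse Ck_on_sum Ck_on_nth Ck_on_cnj_nth o)
       (use herm_self_nonzero in \<open>auto simp: herm_def\<close>)
  then show ?thesis by (simp add: Q_fun_herm[abs_def] divide_inverse)
qed

lemma Ck_on_dQ: "Ck_on k (- {0}) (\<lambda>z. dQ i j z h)"
  using Ck_on_Q_fun[of "Suc k" i j] by (simp add: dQ_frechet)

lemma Ck_on_Gam: "Ck_on k (- {0}) (\<lambda>z. Gam p q r s z h)"
proof -
  note o = open_minus_0
  have v: "Ck_on k (- {0}) (\<lambda>z. v_dvbar q s z h)" for q s
    unfolding v_dvbar_def by (intro Ck_on_sum Ck_on_mult Ck_on_Q_fun Ck_on_dQ o)
  have "Ck_on k (- {0}) (\<lambda>z. if p = r then v_dvbar q s z h else 0)"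
    using v by (cases "p = r") (auto intro: Ck_on_const)
  moreover have "Ck_on k (- {0}) (\<lambda>z. vbar_dv p r z h)"
    unfolding vbar_dv_def by (intro Ck_on_sum Ck_on_mult Ck_on_Q_fun Ck_on_dQ o)
  ultimately show ?thesis
    unfolding Gam_def using v by (intro Ck_on_add Ck_on_diff Ck_on_mult Ck_on_Q_fun o)
qed

section \<open>The state evaluation map is form-valued\<close>

text \<open>
  The factors of the chain belonging to a word \<open>w\<close>, as covectors at \<open>z\<close>. The list \<open>rs\<close> consists of
  the summation indices followed by the last index of the word.
\<close>

definition Gam_word ::
  "('n::finite \<times> 'n) list \<Rightarrow> 'n list \<Rightarrow> nat \<Rightarrow> complex ^ 'n \<Rightarrow> complex ^ 'n \<Rightarrow> complex" where
  "Gam_word w rs i z x = Gam (snd (w ! i)) (rs ! i) (fst (w ! Suc i)) (rs ! Suc i) z (\<lambda>_. x)"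

lemma phi_basis_eq:
  assumes w: "length w = Suc m"
  shows "phi_basis w z h = (\<Sum>qs | length qs = m.
      Q_fun (fst (w ! 0)) ((qs @ [snd (w ! m)]) ! 0) z * alt_prod m (\<lambda>i. Gam_word w (qs @ [snd (w ! m)]) i z) h)"
proof -
  have last: "last w = w ! m" using w by (metis diff_Suc_1 last_conv_nth length_0_conv nat.distinct(1))
  have "wedge_one_forms (map (\<lambda>i. Gam (snd (w ! i)) (rs ! i) (fst (w ! Suc i)) (rs ! Suc i)) [0..<m]) z h
     = alt_prod m (\<lambda>i. Gam_word w rs i z) h" for rs
    by (subst wedge_one_forms_alt_prod)
       (auto simp: Gam_word_def intro!: alt_prod_cong intro: Gam_cong)
  then show ?thesis
    unfolding phi_basis_def last w by (simp add: Let_def)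
qed

lemma phi_in_Omega_CP:
  fixes \<xi> :: "'n::finite tens"
  shows "phi m \<xi> \<in> Omega_CP m"
proof -
  let ?rs = "\<lambda>w qs. qs @ [snd (w ! m)] :: 'n list"
  have eq: "phi m \<xi> z h = (\<Sum>w | length w = Suc m. \<xi> w * (\<Sum>qs | length qs = m.
      Q_fun (fst (w ! 0)) (?rs w qs ! 0) z * alt_prod m (\<lambda>i. Gam_word w (?rs w qs) i z) h))"
    for z :: "complex ^ 'n" and h
    unfolding phi_def by (intro sum.cong refl) (simp add: phi_basis_eq)
  have "alternating_form m (phi m \<xi> z)" if "z \<noteq> 0" for z
    unfolding eq using linear_Gam[OF that]
    by (intro alternating_form_sum alternating_form_alt_prod) (simp add: Gam_word_def[abs_def])
  moreover have "Ck_on k (- {0}) (\<lambda>z. phi m \<xi> z h)" for k h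
    unfolding eq alt_prod_def Gam_word_def
    by (intro Ck_on_sum Ck_on_mult Ck_on_prod Ck_on_const Ck_on_Q_fun Ck_on_Gam open_minus_0)
  moreover have "phi m \<xi> (c *s z) (\<lambda>i. c *s h i + a i *s z) = phi m \<xi> z h"
    if "z \<noteq> 0" "c \<noteq> 0" for z h c a
    unfolding eq alt_prod_def Gam_word_def
    by (simp only: Gam_invariant[OF that] Q_fun_invariant[OF that])
  ultimately show ?thesis by (simp add: Omega_CP_def)
qed

section \<open>The antiholomorphic part of the state evaluation map\<close>

definition dbar_word :: "('n::finite \<times> 'n) list \<Rightarrow> complex ^ 'n \<Rightarrow> nat \<Rightarrow> complex ^ 'n \<Rightarrow> complex" where
  "dbar_word w z i = dbar_Q (fst (w ! i)) (snd (w ! i)) z"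

text \<open>
  Every factor is \<open>z\<^sub>q K\<close> with \<open>q\<close> its first index and \<open>K\<close> depending on the second one. After moving the
  scalars \<open>z\<^sub>q\<close> one step to the left, the sum over all index lists is a product of independent sums
  \<open>\<Sum> z\<^sub>q K\<^sub>i (q)\<close>. Each of them is a single term, since \<open>\<Sum> z\<^sub>q u\<^sub>q = 1\<close> and \<open>\<Sum> z\<^sub>q dbar u\<^sub>q = 0\<close>.
  The second summand on the right-hand side comes from the \<open>\<delta>\<close> in the last factor, whose second index
  is not summed over.
\<close>

lemma chain_contraction:
  fixes w :: "('n::finite \<times> 'n) list"
  assumes z: "z \<noteq> 0"
  shows "(\<Sum>qs | length qs = m. Q_fun (fst (w ! 0)) ((qs @ [snd (w ! m)]) ! 0) z *
            (\<Prod>i<m. antiholo (Gam_word w (qs @ [snd (w ! m)]) i z) (x i)))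
       = (-1) ^ m * (Q_fun (fst (w ! m)) (snd (w ! m)) z * (\<Prod>i<m. dbar_word w z i (x i)))
         + (case m of 0 \<Rightarrow> 0 | Suc l \<Rightarrow>
              if snd (w ! l) = fst (w ! Suc l)
              then (-1) ^ l * (\<Prod>i<l. dbar_word w z i (x i)) * dbar_Q (fst (w ! l)) (snd (w ! Suc l)) z (x l)
              else 0)"
proof -
  define Z where "Z a = z $ a" for a
  define U where "U b = cnj (z $ b) / herm z z" for b
  define D where "D i b = dbar_u b z (x i)" for i b
  define a b where "a i = fst (w ! i)" and "b i = snd (w ! i)" for i
  define K where "K i s = (case i of 0 \<Rightarrow> U s
     | Suc i \<Rightarrow> (if b i = a (Suc i) then D i s else 0) - U s * (Z (a (Suc i)) * D i (b i)))" for i s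
  have ZU: "(\<Sum>q\<in>UNIV. Z q * U q) = 1" and ZD: "(\<Sum>q\<in>UNIV. Z q * D i q) = 0" for i
    unfolding Z_def U_def D_def by (rule sum_nth_u[OF z], rule sum_nth_dbar_u[OF z])
  have Q: "Q_fun i j z = Z i * U j" for i j
    by (simp only: Q_fun_herm Z_def U_def)
  have dQ: "dbar_Q i j z (x l) = Z i * D l j" for i j l
    by (simp only: dbar_Q_def Z_def D_def)
  have G: "antiholo (Gam_word w rs i z) (x i) = Z (rs ! i) * K (Suc i) (rs ! Suc i)" for rs i
    unfolding Gam_word_def[abs_def] antiholo_Gam[OF z] Q dQ a_def[symmetric] b_def[symmetric]
    by (simp add: K_def algebra_simps)
  have "(\<Sum>qs | length qs = m. Q_fun (fst (w ! 0)) ((qs @ [snd (w ! m)]) ! 0) z *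
            (\<Prod>i<m. antiholo (Gam_word w (qs @ [snd (w ! m)]) i z) (x i)))
     = (\<Sum>qs | length qs = m. Z (a 0) * ((\<Prod>i<m. Z (qs ! i) * K i (qs ! i)) * K m (b m)))"
  proof (intro sum.cong refl)
    fix qs :: "'n list" assume "qs \<in> {qs. length qs = m}"
    then have qs: "length qs = m" by simp
    let ?rs = "qs @ [snd (w ! m)]"
    have nth: "?rs ! i = qs ! i" if "i < m" for i using qs that by (simp add: nth_append)
    \<comment> \<open>\<open>K 0 = U\<close> makes the scalar in front of the chain the zeroth term of the shifted product.\<close>
    have "U (?rs ! 0) * (\<Prod>i<m. K (Suc i) (?rs ! Suc i)) = (\<Prod>i<Suc m. K i (?rs ! i))"
      unfolding prod.lessThan_Suc_shift by (simp add: K_def)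
    also have "\<dots> = (\<Prod>i<m. K i (qs ! i)) * K m (b m)"
      using qs nth by (simp add: b_def nth_append)
    finally have K: "U (?rs ! 0) * (\<Prod>i<m. K (Suc i) (?rs ! Suc i)) = (\<Prod>i<m. K i (qs ! i)) * K m (b m)" .
    have "Q_fun (fst (w ! 0)) (?rs ! 0) z * (\<Prod>i<m. antiholo (Gam_word w ?rs i z) (x i))
        = Z (a 0) * (\<Prod>i<m. Z (?rs ! i)) * (U (?rs ! 0) * (\<Prod>i<m. K (Suc i) (?rs ! Suc i)))"
      unfolding G Q prod.distrib a_def by (simp only: mult_ac)
    also have "\<dots> = Z (a 0) * ((\<Prod>i<m. Z (qs ! i) * K i (qs ! i)) * K m (b m))"
      unfolding K using nth by (simp add: prod.distrib)
    finally show "Q_fun (fst (w ! 0)) (?rs ! 0) z * (\<Prod>i<m. antiholo (Gam_word w ?rs i z) (x i))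
        = Z (a 0) * ((\<Prod>i<m. Z (qs ! i) * K i (qs ! i)) * K m (b m))" .
  qed
  also have "\<dots> = Z (a 0) * ((\<Prod>i<m. \<Sum>q\<in>UNIV. Z q * K i q) * K m (b m))"
    unfolding sum_words_prod[symmetric] sum_distrib_left sum_distrib_right ..
  also have "\<dots> = (-1) ^ m * ((Z (a m) * U (b m)) * (\<Prod>i<m. Z (a i) * D i (b i)))
         + (case m of 0 \<Rightarrow> 0 | Suc l \<Rightarrow>
              if b l = a (Suc l)
              then (-1) ^ l * (\<Prod>i<l. Z (a i) * D i (b i)) * (Z (a l) * D l (b (Suc l)))
              else 0)"
  proof (cases m)
    case 0
    then show ?thesis by (simp add: K_def)
  next
    case (Suc l)
    have K0: "(\<Sum>q\<in>UNIV. Z q * K 0 q) = 1" by (simp add: K_def ZU)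
    have KS: "(\<Sum>q\<in>UNIV. Z q * K (Suc i) q) = - 1 * (Z (a (Suc i)) * D i (b i))" for i
    proof -
      have "(\<Sum>q\<in>UNIV. Z q * K (Suc i) q)
         = (if b i = a (Suc i) then (\<Sum>q\<in>UNIV. Z q * D i q) else 0)
           - (\<Sum>q\<in>UNIV. Z q * U q) * (Z (a (Suc i)) * D i (b i))"
        by (simp add: K_def right_diff_distrib sum_subtractf sum_distrib_right mult.assoc)
      then show ?thesis by (simp add: ZU ZD)
    qed
    have Za: "Z (a 0) * (\<Prod>i<l. Z (a (Suc i))) = (\<Prod>i<l. Z (a i)) * Z (a l)"
      using prod.lessThan_Suc_shift[of "\<lambda>i. Z (a i)" l] by (simp add: o_def)
    have "Z (a 0) * ((\<Prod>i<m. \<Sum>q\<in>UNIV. Z q * K i q) * K m (b m))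
        = (-1) ^ l * ((Z (a 0) * (\<Prod>i<l. Z (a (Suc i)))) * (\<Prod>i<l. D i (b i))) * K m (b m)"
      unfolding Suc prod.lessThan_Suc_shift K0 KS prod.distrib prod_constant
      by (simp add: mult_ac)
    also have "\<dots> = (-1) ^ l * (\<Prod>i<l. Z (a i) * D i (b i)) * Z (a l) * K m (b m)"
      unfolding Za prod.distrib by (simp only: mult_ac)
    finally show ?thesis
      unfolding Suc by (simp add: K_def algebra_simps)
  qed
  finally show ?thesis
    unfolding dbar_word_def Q dQ a_def b_def .
qed

text \<open>
  The form \<open>(dbar Q\<^sub>w\<^sub>0 \<and> ... \<and> dbar Q\<^sub>w\<^sub>m\<^sub>-\<^sub>1) Q\<^sub>w\<^sub>m\<close>.
\<close>

definition word_form :: "nat \<Rightarrow> ('n::finite \<times> 'n) list \<Rightarrow> 'n form" where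
  "word_form m w z h = Q_fun (fst (w ! m)) (snd (w ! m)) z * alt_prod m (dbar_word w z) h"

text \<open>
  The \<open>\<delta>\<close>-term of \<open>chain_contraction\<close> depends on the word only through the product of its last two
  matrices. Summed against an element of the universal calculus it therefore vanishes, for each
  permutation of the arguments separately.
\<close>

lemma type_proj_phi:
  fixes \<xi> :: "'n::finite tens"
  assumes \<xi>: "\<xi> \<in> Omega_uni m" and z: "z \<noteq> 0"
  shows "type_proj 0 m (phi m \<xi>) z h = (-1) ^ m * (\<Sum>w | length w = Suc m. \<xi> w * word_form m w z h)"
proof -
  define rest where "rest p w = (case m of 0 \<Rightarrow> 0 | Suc l \<Rightarrow>
      if snd (w ! l) = fst (w ! Suc l)
      then (-1) ^ l * (\<Prod>i<l. dbar_word w z i (h (p i))) * dbar_Q (fst (w ! l)) (snd (w ! Suc l)) z (h (p l))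
      else 0)" for p and w :: "('n \<times> 'n) list"
  have rest: "(\<Sum>w | length w = Suc m. \<xi> w * rest p w) = 0" for p
  proof (cases m)
    case 0
    then show ?thesis by (simp add: rest_def)
  next
    case (Suc l)
    have "(\<Sum>w | length w = Suc m. \<xi> w * rest p w)
       = (\<Sum>w | length w = Suc m. \<xi> w * (if snd (w ! l) = fst (w ! Suc l)
            then (\<lambda>u. (-1) ^ l * (\<Prod>i<Suc l. dbar_word u z i (h (p i))))
                   (take l w @ (fst (w ! l), snd (w ! Suc l)) # drop (Suc (Suc l)) w) else 0))"
      by (intro sum.cong refl arg_cong2[where f = "(*)"])
         (simp add: rest_def Suc dbar_word_def nth_append mult.assoc)
    also have "\<dots> = 0"
      by (rule sum_mult_neighbours_eq_0) (use \<xi> Suc in \<open>auto simp: Omega_uni_def\<close>)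
    finally show ?thesis .
  qed
  have basis: "type_proj 0 m (phi_basis w) z h
      = (-1) ^ m * word_form m w z h + (\<Sum>p | p permutes {..<m}. of_int (sign p) * rest p w)"
    if w: "length w = Suc m" for w
  proof -
    let ?rs = "\<lambda>qs. qs @ [snd (w ! m)] :: 'n list"
    have "type_proj 0 m (phi_basis w) z h
       = (\<Sum>qs | length qs = m. Q_fun (fst (w ! 0)) (?rs qs ! 0) z *
            type_proj 0 m (\<lambda>z. alt_prod m (\<lambda>i. Gam_word w (?rs qs) i z)) z h)"
      by (rule type_proj_sum) (rule phi_basis_eq[OF w])
    also have "\<dots> = (\<Sum>qs | length qs = m. Q_fun (fst (w ! 0)) (?rs qs ! 0) z *
            alt_prod m (\<lambda>i. antiholo (Gam_word w (?rs qs) i z)) h)"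
      by (intro sum.cong refl arg_cong2[where f = "(*)"] type_proj_alt_prod)
    also have "\<dots> = (\<Sum>p | p permutes {..<m}. of_int (sign p) *
         (\<Sum>qs | length qs = m. Q_fun (fst (w ! 0)) (?rs qs ! 0) z *
            (\<Prod>i<m. antiholo (Gam_word w (?rs qs) i z) (h (p i)))))"
      unfolding alt_prod_def sum_distrib_left
      by (subst sum.swap) (simp only: mult.left_commute)
    also have "\<dots> = (\<Sum>p | p permutes {..<m}. of_int (sign p) *
         ((-1) ^ m * (Q_fun (fst (w ! m)) (snd (w ! m)) z * (\<Prod>i<m. dbar_word w z i (h (p i)))) + rest p w))"
      unfolding rest_def by (simp only: chain_contraction[OF z, where x = "\<lambda>i. h (_ i)"])
    also have "\<dots> = (-1) ^ m * word_form m w z h + (\<Sum>p | p permutes {..<m}. of_int (sign p) * rest p w)"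
      by (simp add: distrib_left sum.distrib word_form_def alt_prod_def sum_distrib_left mult_ac)
    finally show ?thesis .
  qed
  have "type_proj 0 m (phi m \<xi>) z h = (\<Sum>w | length w = Suc m. \<xi> w * type_proj 0 m (phi_basis w) z h)"
    by (rule type_proj_sum) (simp add: phi_def)
  also have "\<dots> = (\<Sum>w | length w = Suc m. (-1) ^ m * (\<xi> w * word_form m w z h))
      + (\<Sum>w | length w = Suc m. \<Sum>p | p permutes {..<m}. of_int (sign p) * (\<xi> w * rest p w))"
    by (simp add: basis distrib_left sum.distrib sum_distrib_left mult_ac)
  also have "(\<Sum>w | length w = Suc m. \<Sum>p | p permutes {..<m}. of_int (sign p) * (\<xi> w * rest p w))
      = (\<Sum>p | p permutes {..<m}. of_int (sign p) * (\<Sum>w | length w = Suc m. \<xi> w * rest p w))"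
    by (subst sum.swap) (simp only: sum_distrib_left)
  finally show ?thesis by (simp add: rest sum_distrib_left)
qed

section \<open>The operator dbar on products of the forms dbar Q\<close>

text \<open>
  The derivative of the value \<open>dbar Q\<^sub>a\<^sub>b\<close> on a fixed vector \<open>x\<close>, in the direction \<open>y\<close>.
\<close>

definition ddbar_Q ::
  "'n::finite \<Rightarrow> 'n \<Rightarrow> complex ^ 'n \<Rightarrow> complex ^ 'n \<Rightarrow> complex ^ 'n \<Rightarrow> complex" where
  "ddbar_Q a b z x y =
      (y $ a * cnj (x $ b)) / herm z z
      - (z $ a * cnj (x $ b) * (herm y z + herm z y)
         + (y $ a * cnj (z $ b) + z $ a * cnj (y $ b)) * herm z x
         + z $ a * cnj (z $ b) * herm y x) / (herm z z)\<^sup>2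
      + 2 * z $ a * cnj (z $ b) * herm z x * (herm y z + herm z y) / (herm z z) ^ 3"

lemma dbar_Q_has_derivative:
  assumes "z \<noteq> 0"
  shows "((\<lambda>z. dbar_Q a b z x) has_derivative ddbar_Q a b z x) (at z)"
proof -
  note nz = herm_self_nonzero[OF assms]
  have "((\<lambda>z. z $ a * cnj (x $ b) / herm z z) has_derivative
      (\<lambda>y. (y $ a * cnj (x $ b)) / herm z z
         - z $ a * cnj (x $ b) * (herm y z + herm z y) / (herm z z)\<^sup>2)) (at z)"
    by (rule has_derivative_eq_rhs,
        rule has_derivative_divide[OF has_derivative_mult_left[OF has_derivative_nth]
            has_derivative_herm_self nz])
       (use nz in \<open>simp add: fun_eq_iff field_simps power2_eq_square\<close>)
  moreover have "((\<lambda>z. z $ a * cnj (z $ b) * herm z x / (herm z z * herm z z)) has_derivative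
      (\<lambda>y. ((y $ a * cnj (z $ b) + z $ a * cnj (y $ b)) * herm z x
         + z $ a * cnj (z $ b) * herm y x) / (herm z z)\<^sup>2
         - 2 * z $ a * cnj (z $ b) * herm z x * (herm y z + herm z y) / (herm z z) ^ 3)) (at z)"
    by (rule has_derivative_eq_rhs,
        rule has_derivative_divide[OF has_derivative_mult[OF
            has_derivative_mult[OF has_derivative_nth has_derivative_cnj_nth] has_derivative_herm_left]
            has_derivative_mult[OF has_derivative_herm_self has_derivative_herm_self]])
       (use nz in \<open>simp_all add: fun_eq_iff field_simps power2_eq_square power3_eq_cube\<close>)
  ultimately have "((\<lambda>z. z $ a * cnj (x $ b) / herm z z
       - z $ a * cnj (z $ b) * herm z x / (herm z z * herm z z)) has_derivative ddbar_Q a b z x) (at z)"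
    by (rule has_derivative_eq_rhs[OF has_derivative_diff])
       (simp add: fun_eq_iff ddbar_Q_def add_divide_distrib)
  then show ?thesis
    by (simp add: dbar_Q_def dbar_u_def right_diff_distrib power2_eq_square mult.assoc)
qed

lemma antiholo_ddbar_Q:
  assumes "z \<noteq> 0"
  shows "antiholo (ddbar_Q a b z x) y
      = (2 * z $ a * cnj (z $ b) * herm z x * herm z y / herm z z
         - z $ a * cnj (x $ b) * herm z y - z $ a * cnj (y $ b) * herm z x) / (herm z z)\<^sup>2"
  using herm_self_nonzero[OF assms]
  by (simp add: antiholo_def ddbar_Q_def herm_simps field_simps power2_eq_square power3_eq_cube)

text \<open>
  This symmetry is \<open>dbar dbar Q\<^sub>a\<^sub>b = 0\<close>.
\<close>

lemma antiholo_ddbar_Q_symmetric: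
  assumes "z \<noteq> 0"
  shows "antiholo (ddbar_Q a b z x) y = antiholo (ddbar_Q a b z y) x"
  by (simp add: antiholo_ddbar_Q[OF assms] algebra_simps)

lemma alt_prod_slot:
  assumes "i < n"
  shows "alt_prod n (c(i := f)) h
    = (\<Sum>p | p permutes {..<n}. of_int (sign p) * (f (h (p i)) * (\<Prod>j\<in>{..<n} - {i}. c j (h (p j)))))"
proof -
  have "(\<Prod>j<n. (c(i := f)) j (h (p j))) = f (h (p i)) * (\<Prod>j\<in>{..<n} - {i}. c j (h (p j)))" for p
    using assms by (subst prod.remove[of _ i]) auto
  then show ?thesis by (simp only: alt_prod_def)
qed

lemma alt_prod_slot_sum:
  assumes "i < n"
  shows "(\<Sum>k\<in>K. a k * alt_prod n (c(i := f k)) h) = alt_prod n (c(i := \<lambda>x. \<Sum>k\<in>K. a k * f k x)) h"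
proof -
  have "(\<Sum>k\<in>K. a k * alt_prod n (c(i := f k)) h)
      = (\<Sum>k\<in>K. \<Sum>p | p permutes {..<n}.
          of_int (sign p) * (a k * f k (h (p i)) * (\<Prod>j\<in>{..<n} - {i}. c j (h (p j)))))"
    by (simp only: alt_prod_slot[OF assms] sum_distrib_left mult_ac)
  also have "\<dots> = alt_prod n (c(i := \<lambda>x. \<Sum>k\<in>K. a k * f k x)) h"
    unfolding alt_prod_slot[OF assms] sum_distrib_left sum_distrib_right by (rule sum.swap)
  finally show ?thesis .
qed

text \<open>
  The argument list in the \<open>k\<close>-th term of the exterior derivative.
\<close>

definition skip :: "nat \<Rightarrow> (nat \<Rightarrow> 'v) \<Rightarrow> nat \<Rightarrow> 'v" where
  "skip k h = (\<lambda>i. if i < k then h i else h (Suc i))"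

text \<open>
  The alternating sum over the omitted argument in the exterior derivative, together with the
  permutations of the remaining arguments, is a sum over all permutations of \<open>m + 1\<close> arguments. The
  omitted argument is put into the last place, which is the origin of the sign \<open>(-1)\<^sup>m\<close>.
\<close>

lemma signed_sum_skip:
  fixes \<Phi> :: "(nat \<Rightarrow> 'v) \<Rightarrow> 'v \<Rightarrow> complex"
  assumes \<Phi>: "\<And>g g' y. (\<And>i. i < m \<Longrightarrow> g i = g' i) \<Longrightarrow> \<Phi> g y = \<Phi> g' y"
  shows "(\<Sum>k\<le>m. (-1) ^ k * (\<Sum>p | p permutes {..<m}. of_int (sign p) * \<Phi> (\<lambda>i. skip k h (p i)) (h k)))
     = (-1) ^ m * (\<Sum>\<sigma> | \<sigma> permutes {..<Suc m}. of_int (sign \<sigma>) * \<Phi> (\<lambda>i. h (\<sigma> i)) (h (\<sigma> m)))"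
proof -
  have "\<Phi> (\<lambda>i. h ((move_last m k \<circ> p) i)) (h ((move_last m k \<circ> p) m)) = \<Phi> (\<lambda>i. skip k h (p i)) (h k)"
    if k: "k \<le> m" and p: "p permutes {..<m}" for k p
  proof -
    have "p m = m" using p by (simp add: permutes_not_in)
    then have "(move_last m k \<circ> p) m = k" using k by (simp add: move_last_def)
    moreover have "\<Phi> (\<lambda>i. h ((move_last m k \<circ> p) i)) (h k) = \<Phi> (\<lambda>i. skip k h (p i)) (h k)"
    proof (rule \<Phi>)
      show "h ((move_last m k \<circ> p) i) = skip k h (p i)" if "i < m" for i
        using permutes_in_image[OF p, of i] that by (simp add: move_last_def skip_def)
    qed
    ultimately show ?thesis by (simp only:)
  qed
  then have "(\<Sum>\<sigma> | \<sigma> permutes {..<Suc m}. of_int (sign \<sigma>) * \<Phi> (\<lambda>i. h (\<sigma> i)) (h (\<sigma> m)))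
     = (\<Sum>k\<le>m. \<Sum>p | p permutes {..<m}. (-1) ^ (m - k) * of_int (sign p) * \<Phi> (\<lambda>i. skip k h (p i)) (h k))"
    by (subst signed_sum_Suc) (intro sum.cong refl, simp)
  also have "\<dots> = (\<Sum>k\<le>m. (-1) ^ (m - k) * (\<Sum>p | p permutes {..<m}. of_int (sign p) * \<Phi> (\<lambda>i. skip k h (p i)) (h k)))"
    by (simp only: sum_distrib_left mult.assoc)
  finally show ?thesis
  proof (simp only: sum_distrib_left[of "(-1) ^ m" _ "{..m}"], intro sum.cong refl, goal_cases)
    case (1 k)
    have "(-1 :: complex) ^ m * (-1) ^ (m - k) = (-1) ^ (m + (m - k))"
      by (rule power_add[symmetric])
    also have "m + (m - k) = k + 2 * (m - k)" using 1 by simp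
    also have "(-1 :: complex) ^ (k + 2 * (m - k)) = (-1) ^ k" by (simp add: power_add power_mult)
    finally show ?case by (simp flip: mult.assoc)
  qed
qed

lemma signed_sum_skip_last:
  "(\<Sum>k\<le>m. (-1) ^ k * (f (h k) * alt_prod m c (skip k h))) = (-1) ^ m * alt_prod (Suc m) (c(m := f)) h"
proof -
  have "(\<Sum>k\<le>m. (-1) ^ k * (f (h k) * alt_prod m c (skip k h)))
      = (\<Sum>k\<le>m. (-1) ^ k * (\<Sum>p | p permutes {..<m}. of_int (sign p) *
          (f (h k) * (\<Prod>i<m. c i (skip k h (p i))))))"
    by (simp only: alt_prod_def sum_distrib_left mult.left_commute)
  also have "\<dots> = (-1) ^ m * (\<Sum>\<sigma> | \<sigma> permutes {..<Suc m}. of_int (sign \<sigma>) *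
          (f (h (\<sigma> m)) * (\<Prod>i<m. c i (h (\<sigma> i)))))"
    by (rule signed_sum_skip[where \<Phi> = "\<lambda>g y. f y * (\<Prod>i<m. c i (g i))"]) simp
  also have "\<dots> = (-1) ^ m * alt_prod (Suc m) (c(m := f)) h"
    by (simp add: alt_prod_def mult.commute)
  finally show ?thesis .
qed

lemma signed_sum_skip_symmetric:
  assumes i: "i < m" and S: "\<And>x y. S x y = S y x"
  shows "(\<Sum>k\<le>m. (-1) ^ k * alt_prod m (c(i := \<lambda>x. S x (h k))) (skip k h)) = 0"
proof -
  have "(\<Sum>k\<le>m. (-1) ^ k * alt_prod m (c(i := \<lambda>x. S x (h k))) (skip k h))
      = (-1) ^ m * (\<Sum>\<sigma> | \<sigma> permutes {..<Suc m}. of_int (sign \<sigma>) *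
          (S (h (\<sigma> i)) (h (\<sigma> m)) * (\<Prod>j\<in>{..<m} - {i}. c j (h (\<sigma> j)))))"
    unfolding alt_prod_slot[OF i]
    by (rule signed_sum_skip[where \<Phi> = "\<lambda>g y. S (g i) y * (\<Prod>j\<in>{..<m} - {i}. c j (g j))"])
       (use i in simp)
  also have "(\<Sum>\<sigma> | \<sigma> permutes {..<Suc m}. of_int (sign \<sigma>) *
          (S (h (\<sigma> i)) (h (\<sigma> m)) * (\<Prod>j\<in>{..<m} - {i}. c j (h (\<sigma> j))))) = 0"
  proof (rule signed_sum_eq_0_right[of i _ m])
    fix \<sigma> :: "nat \<Rightarrow> nat"
    have "(\<sigma> \<circ> Transposition.transpose i m) j = \<sigma> j" if "j \<in> {..<m} - {i}" for j
      using that by (auto simp: Transposition.transpose_def)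
    moreover have "(\<sigma> \<circ> Transposition.transpose i m) i = \<sigma> m" "(\<sigma> \<circ> Transposition.transpose i m) m = \<sigma> i"
      by simp_all
    ultimately show "S (h ((\<sigma> \<circ> Transposition.transpose i m) i)) (h ((\<sigma> \<circ> Transposition.transpose i m) m)) *
         (\<Prod>j\<in>{..<m} - {i}. c j (h ((\<sigma> \<circ> Transposition.transpose i m) j)))
       = S (h (\<sigma> i)) (h (\<sigma> m)) * (\<Prod>j\<in>{..<m} - {i}. c j (h (\<sigma> j)))"
      by (simp only: S[of "h (\<sigma> m)"] cong: prod.cong)
  qed (use i in auto)
  finally show ?thesis by (simp only: mult_zero_right)
qed

lemma ddbar_Q_antilinear: "ddbar_Q a b z (\<i> *s x) y = - \<i> * ddbar_Q a b z x y"
  by (simp add: ddbar_Q_def herm_simps algebra_simps add_divide_distrib diff_divide_distrib)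

text \<open>
  The derivative of \<open>word_form\<close> in the direction \<open>y\<close> by the product rule. One factor at a time
  is replaced by its derivative.
\<close>

definition d_word_form :: "nat \<Rightarrow> ('n::finite \<times> 'n) list \<Rightarrow> complex ^ 'n \<Rightarrow> (nat \<Rightarrow> complex ^ 'n) \<Rightarrow> complex ^ 'n \<Rightarrow> complex" where
  "d_word_form m w z g y =
     dQ_form (fst (w ! m)) (snd (w ! m)) z y * alt_prod m (dbar_word w z) g
     + Q_fun (fst (w ! m)) (snd (w ! m)) z *
       (\<Sum>i<m. alt_prod m ((dbar_word w z)(i := \<lambda>x. ddbar_Q (fst (w ! i)) (snd (w ! i)) z x y)) g)"

lemma word_form_has_derivative:
  assumes z: "z \<noteq> 0"
  shows "((\<lambda>z. word_form m w z g) has_derivative d_word_form m w z g) (at z)"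
proof -
  have "((\<lambda>z. alt_prod m (dbar_word w z) g) has_derivative
     (\<lambda>y. \<Sum>p | p permutes {..<m}. of_int (sign p) *
        (\<Sum>i<m. ddbar_Q (fst (w ! i)) (snd (w ! i)) z (g (p i)) y *
           (\<Prod>j\<in>{..<m} - {i}. dbar_word w z j (g (p j)))))) (at z)"
    unfolding alt_prod_def dbar_word_def
    by (intro has_derivative_sum has_derivative_mult_right has_derivative_prod dbar_Q_has_derivative[OF z])
  moreover have "(\<Sum>p | p permutes {..<m}. of_int (sign p) *
        (\<Sum>i<m. ddbar_Q (fst (w ! i)) (snd (w ! i)) z (g (p i)) y *
           (\<Prod>j\<in>{..<m} - {i}. dbar_word w z j (g (p j)))))
     = (\<Sum>i<m. alt_prod m ((dbar_word w z)(i := \<lambda>x. ddbar_Q (fst (w ! i)) (snd (w ! i)) z x y)) g)" for y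
    unfolding sum_distrib_left by (subst sum.swap) (simp add: alt_prod_slot)
  ultimately have "((\<lambda>z. alt_prod m (dbar_word w z) g) has_derivative
     (\<lambda>y. \<Sum>i<m. alt_prod m ((dbar_word w z)(i := \<lambda>x. ddbar_Q (fst (w ! i)) (snd (w ! i)) z x y)) g)) (at z)"
    by simp
  from has_derivative_mult[OF Q_fun_has_derivative[OF z] this]
  show ?thesis
    unfolding word_form_def d_word_form_def by (simp add: add.commute)
qed

lemma d_word_form_antilinear:
  assumes j: "j < m"
  shows "d_word_form m w z (g(j := \<i> *s g j)) y = - \<i> * d_word_form m w z g y"
proof -
  have "alt_prod m (dbar_word w z) (g(j := \<i> *s g j)) = - \<i> * alt_prod m (dbar_word w z) g"
    by (rule alt_prod_antilinear[OF _ j]) (simp add: dbar_word_def dbar_Q_scale)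
  moreover have "alt_prod m ((dbar_word w z)(i := \<lambda>x. ddbar_Q (fst (w ! i)) (snd (w ! i)) z x y)) (g(j := \<i> *s g j))
     = - \<i> * alt_prod m ((dbar_word w z)(i := \<lambda>x. ddbar_Q (fst (w ! i)) (snd (w ! i)) z x y)) g" for i
    by (rule alt_prod_antilinear[OF _ j]) (simp add: dbar_word_def dbar_Q_scale ddbar_Q_antilinear)
  ultimately show ?thesis
    unfolding d_word_form_def
    by (simp only: sum_distrib_left[symmetric]) (simp add: algebra_simps)
qed

lemma antiholo_d_word_form:
  "antiholo (d_word_form m w z g) y
     = dbar_word w z m y * alt_prod m (dbar_word w z) g
     + Q_fun (fst (w ! m)) (snd (w ! m)) z *
       (\<Sum>i<m. alt_prod m ((dbar_word w z)(i :=
          \<lambda>x. antiholo (ddbar_Q (fst (w ! i)) (snd (w ! i)) z x) y)) g)"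
proof -
  let ?A = "\<lambda>i y. alt_prod m ((dbar_word w z)(i := \<lambda>x. ddbar_Q (fst (w ! i)) (snd (w ! i)) z x y)) g"
  have "(?A i y + \<i> * ?A i (\<i> *s y)) / 2
      = alt_prod m ((dbar_word w z)(i := \<lambda>x. antiholo (ddbar_Q (fst (w ! i)) (snd (w ! i)) z x) y)) g"
    if "i < m" for i
    \<comment> \<open>The conjugate-linear part is a sum of two terms, indexed by the Booleans.\<close>
    using alt_prod_slot_sum[OF that, of "\<lambda>b. if b then 1 / 2 else \<i> / 2" "dbar_word w z"
        "\<lambda>b x. ddbar_Q (fst (w ! i)) (snd (w ! i)) z x (if b then y else \<i> *s y)" g UNIV]
    by (simp add: UNIV_bool antiholo_def add_divide_distrib add.commute)
  then have sum: "(\<Sum>i<m. alt_prod m ((dbar_word w z)(i :=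
          \<lambda>x. antiholo (ddbar_Q (fst (w ! i)) (snd (w ! i)) z x) y)) g)
     = ((\<Sum>i<m. ?A i y) + \<i> * (\<Sum>i<m. ?A i (\<i> *s y))) / 2"
    by (simp add: sum_distrib_left sum_divide_distrib flip: sum.distrib)
  have dQ: "dbar_word w z m y = (dQ_form (fst (w ! m)) (snd (w ! m)) z y
      + \<i> * dQ_form (fst (w ! m)) (snd (w ! m)) z (\<i> *s y)) / 2"
    unfolding dbar_word_def antiholo_dQ[symmetric] by (simp add: antiholo_def)
  have gen: "((d * A + q * X) + \<i> * (d' * A + q * X')) / 2 = (d + \<i> * d') / 2 * A + q * ((X + \<i> * X') / 2)"
    for d d' A q X X' :: complex
    by (simp add: field_simps)
  show ?thesis
    unfolding sum dQ unfolding antiholo_def d_word_form_def by (rule gen)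
qed

text \<open>
  The exterior derivative differentiates in the direction \<open>h k\<close> and evaluates the form on the other
  arguments, in which it is conjugate-linear. So the projection only takes the conjugate-linear part
  in the direction of differentiation.
\<close>

lemma type_proj_d_word_form:
  assumes k: "k \<le> m"
  shows "type_proj 0 (Suc m) (\<lambda>z h. d_word_form m w z (skip k h) (h k)) z h
       = antiholo (d_word_form m w z (skip k h)) (h k)"
proof -
  have upd: "skip k (h(j := v)) = (if j < k then (skip k h)(j := v) else (skip k h)(j - 1 := v))"
    if "j \<noteq> k" for h :: "nat \<Rightarrow> complex ^ 'a" and j v
    using that by (auto simp: skip_def fun_eq_iff)
  have skip_k: "skip k (h(k := v)) = skip k h" for h :: "nat \<Rightarrow> complex ^ 'a" and v
    by (auto simp: skip_def fun_eq_iff)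
  have "d_word_form m w z (skip k (h(j := \<i> *s h j))) ((h(j := \<i> *s h j)) k)
      = - \<i> * d_word_form m w z (skip k h) (h k)" if j: "j < Suc m" "j \<noteq> k" for h j
  proof (cases "j < k")
    case True
    then have "skip k h j = h j" by (simp add: skip_def)
    then show ?thesis
      using d_word_form_antilinear[of j m w z "skip k h" "h k"] j k True by (simp add: upd)
  next
    case False
    then obtain l where l: "j = Suc l" using j by (cases j) auto
    then have "skip k h l = h j" using False j by (simp add: skip_def)
    then show ?thesis
      using d_word_form_antilinear[of l m w z "skip k h" "h k"] j False l by (simp add: upd)
  qed
  from type_proj_antilinear_except[of k "Suc m" "\<lambda>h. d_word_form m w z (skip k h) (h k)", OF _ this]
  show ?thesis
    using k by (simp add: type_proj_0 skip_k antiholo_def)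
qed

text \<open>
  Antisymmetrisation leaves only the term in which the scalar \<open>Q\<^sub>w\<^sub>m\<close> is differentiated, with its
  differential moved into the last place. The other terms contain \<open>dbar dbar Q = 0\<close>.
\<close>

lemma antiholo_d_word_form_alternating_sum:
  assumes z: "z \<noteq> 0"
  shows "(\<Sum>k\<le>m. (-1) ^ k * antiholo (d_word_form m w z (skip k h)) (h k))
       = (-1) ^ m * alt_prod (Suc m) (dbar_word w z) h"
proof -
  have "(\<Sum>k\<le>m. (-1) ^ k * antiholo (d_word_form m w z (skip k h)) (h k))
     = (\<Sum>k\<le>m. (-1) ^ k * (dbar_word w z m (h k) * alt_prod m (dbar_word w z) (skip k h)))
       + Q_fun (fst (w ! m)) (snd (w ! m)) z * (\<Sum>i<m. \<Sum>k\<le>m. (-1) ^ k *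
          alt_prod m ((dbar_word w z)(i :=
            \<lambda>x. antiholo (ddbar_Q (fst (w ! i)) (snd (w ! i)) z x) (h k))) (skip k h))"
    unfolding antiholo_d_word_form distrib_left sum.distrib sum_distrib_left
    by (subst (2) sum.swap) (simp only: mult.left_commute)
  also have "(\<Sum>i<m. \<Sum>k\<le>m. (-1) ^ k *
          alt_prod m ((dbar_word w z)(i :=
            \<lambda>x. antiholo (ddbar_Q (fst (w ! i)) (snd (w ! i)) z x) (h k))) (skip k h)) = 0"
    by (intro sum.neutral ballI signed_sum_skip_symmetric
        [where S = "\<lambda>x y. antiholo (ddbar_Q _ _ z x) y"] antiholo_ddbar_Q_symmetric[OF z]) simp
  finally show ?thesis
    by (simp add: signed_sum_skip_last)
qed

lemma dbar_type_proj_phi: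
  assumes \<xi>: "\<xi> \<in> Omega_uni m" and z: "z \<noteq> 0"
  shows "dbar 0 m (type_proj 0 m (phi m \<xi>)) z h
       = (\<Sum>w | length w = Suc m. \<xi> w * alt_prod (Suc m) (dbar_word w z) h)"
proof -
  let ?\<omega> = "type_proj 0 m (phi m \<xi>)"
  have "((\<lambda>y. ?\<omega> y g) has_derivative
      (\<lambda>y. (-1) ^ m * (\<Sum>w | length w = Suc m. \<xi> w * d_word_form m w z g y))) (at z)" for g
  \<comment> \<open>The closed formula holds on the whole punctured space, hence near \<open>z\<close>.\<close>
  proof (rule has_derivative_transform_within_open)
    show "((\<lambda>y. (-1) ^ m * (\<Sum>w | length w = Suc m. \<xi> w * word_form m w y g)) has_derivative
      (\<lambda>y. (-1) ^ m * (\<Sum>w | length w = Suc m. \<xi> w * d_word_form m w z g y))) (at z)"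
      by (intro has_derivative_mult_right has_derivative_sum word_form_has_derivative z)
    show "(-1) ^ m * (\<Sum>w | length w = Suc m. \<xi> w * word_form m w x g) = ?\<omega> x g"
      if "x \<in> - {0}" for x
      using type_proj_phi[OF \<xi>, of x g] that by simp
  qed (use z open_minus_0 in auto)
  from frechet_derivative_at[OF this, symmetric]
  have "ext_d m ?\<omega> z h = (\<Sum>k\<le>m. (-1) ^ k * ((-1) ^ m *
      (\<Sum>w | length w = Suc m. \<xi> w * d_word_form m w z (skip k h) (h k))))" for h
    by (simp add: ext_d_def flip: skip_def)
  then have "ext_d m ?\<omega> z h = (\<Sum>(w, k)\<in>{w. length w = Suc m} \<times> {..m}.
      ((-1) ^ m * \<xi> w * (-1) ^ k) * d_word_form m w z (skip k h) (h k))" for h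
    unfolding sum.cartesian_product[symmetric]
    by (subst sum.swap) (simp add: sum_distrib_left mult_ac)
  then have "dbar 0 m ?\<omega> z h = (\<Sum>wk\<in>{w. length w = Suc m} \<times> {..m}.
      ((-1) ^ m * \<xi> (fst wk) * (-1) ^ snd wk) *
      type_proj 0 (Suc m) (\<lambda>z h. d_word_form m (fst wk) z (skip (snd wk) h) (h (snd wk))) z h)"
    unfolding dbar_def by (intro type_proj_sum) (simp add: case_prod_beta)
  also have "\<dots> = (\<Sum>(w, k)\<in>{w. length w = Suc m} \<times> {..m}.
      ((-1) ^ m * \<xi> w * (-1) ^ k) * antiholo (d_word_form m w z (skip k h)) (h k))"
    by (intro sum.cong) (auto simp: type_proj_d_word_form)
  also have "\<dots> = (\<Sum>w | length w = Suc m. \<xi> w * ((-1) ^ m *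
      (\<Sum>k\<le>m. (-1) ^ k * antiholo (d_word_form m w z (skip k h)) (h k))))"
    unfolding sum.cartesian_product[symmetric] by (simp add: sum_distrib_left mult_ac)
  also have "\<dots> = (\<Sum>w | length w = Suc m. \<xi> w * alt_prod (Suc m) (dbar_word w z) h)"
    unfolding antiholo_d_word_form_alternating_sum[OF z]
    by (simp flip: mult.assoc power_add)
  finally show ?thesis .
qed

section \<open>The cochain property\<close>

text \<open>
  Apply the formula for the \<open>(0,m+1)\<close>-part to \<open>d \<xi>\<close>. The sum over the inserted basis matrices
  \<open>E\<^sub>c\<^sub>c\<close> gives zero in a slot that carries \<open>dbar Q\<^sub>c\<^sub>c\<close> and one in the last slot, which carries \<open>Q\<^sub>c\<^sub>c\<close>.
  The sign of the remaining term is the sign in the formula.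
\<close>

lemma type_proj_phi_d_uni:
  fixes \<xi> :: "'n::finite tens"
  assumes \<xi>: "\<xi> \<in> Omega_uni m" and z: "z \<noteq> 0"
  shows "type_proj 0 (Suc m) (phi (Suc m) (d_uni m \<xi>)) z h
       = (\<Sum>w | length w = Suc m. \<xi> w * alt_prod (Suc m) (dbar_word w z) h)"
proof -
  have inner: "(\<Sum>c\<in>UNIV. word_form (Suc m) (take k w @ (c, c) # drop k w) z h) = 0"
    if k: "k \<le> m" and w: "length w = Suc m" for k and w :: "('n \<times> 'n) list"
  proof -
    \<comment> \<open>The entry of \<open>v\<close> at position \<open>k\<close> is arbitrary. It is overwritten in each term of the sum.\<close>
    define v where "v = take k w @ w ! 0 # drop k w"
    have nth: "(take k w @ (c, c) # drop k w) ! i = (if i = k then (c, c) else v ! i)" for c i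
      using w k by (auto simp: v_def nth_append nth_Cons')
    have "dbar_word (take k w @ (c, c) # drop k w) z = (dbar_word v z)(k := dbar_Q c c z)" for c
      by (simp add: fun_eq_iff dbar_word_def nth)
    moreover have "(take k w @ (c, c) # drop k w) ! Suc m = v ! Suc m" for c
      using k by (simp add: nth)
    ultimately have "word_form (Suc m) (take k w @ (c, c) # drop k w) z h
        = Q_fun (fst (v ! Suc m)) (snd (v ! Suc m)) z *
          (1 * alt_prod (Suc m) ((dbar_word v z)(k := dbar_Q c c z)) h)" for c
      by (simp only: word_form_def mult_1)
    then have "(\<Sum>c\<in>UNIV. word_form (Suc m) (take k w @ (c, c) # drop k w) z h)
       = Q_fun (fst (v ! Suc m)) (snd (v ! Suc m)) z *
          alt_prod (Suc m) ((dbar_word v z)(k := \<lambda>x. \<Sum>c\<in>UNIV. 1 * dbar_Q c c z x)) h"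
      using k alt_prod_slot_sum[of k "Suc m" "\<lambda>_. 1" "dbar_word v z" "\<lambda>c. dbar_Q c c z" h UNIV]
      by (simp flip: sum_distrib_left)
    also have "\<dots> = 0"
      using k by (simp add: sum_dbar_Q[OF z] alt_prod_slot)
    finally show ?thesis .
  qed
  have last: "(\<Sum>c\<in>UNIV. word_form (Suc m) (take (Suc m) w @ (c, c) # drop (Suc m) w) z h)
      = alt_prod (Suc m) (dbar_word w z) h"
    if w: "length w = Suc m" for w :: "('n \<times> 'n) list"
  proof -
    have "alt_prod (Suc m) (dbar_word (w @ [(c, c)]) z) h = alt_prod (Suc m) (dbar_word w z) h" for c
      using w by (intro alt_prod_cong) (simp add: dbar_word_def nth_append)
    then show ?thesis
      using w sum_Q_fun[OF z] by (simp add: word_form_def nth_append flip: sum_distrib_right)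
  qed
  have "(\<Sum>k\<le>Suc m. (-1) ^ k * (\<Sum>c\<in>UNIV. word_form (Suc m) (take k w @ (c, c) # drop k w) z h))
      = (-1) ^ Suc m * alt_prod (Suc m) (dbar_word w z) h"
    if w: "length w = Suc m" for w :: "('n \<times> 'n) list"
    unfolding sum.atMost_Suc last[OF w] using inner[OF _ w] by simp
  then have "type_proj 0 (Suc m) (phi (Suc m) (d_uni m \<xi>)) z h
     = (-1) ^ Suc m * (\<Sum>w | length w = Suc m. \<xi> w * ((-1) ^ Suc m * alt_prod (Suc m) (dbar_word w z) h))"
    unfolding type_proj_phi[OF d_uni_in_Omega_uni[OF \<xi>] z] sum_d_uni
    by (intro arg_cong2[where f = "(*)"] sum.cong refl) auto
  also have "\<dots> = (\<Sum>w | length w = Suc m. \<xi> w * alt_prod (Suc m) (dbar_word w z) h)"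
    unfolding sum_distrib_left
  proof (rule sum.cong[OF refl])
    show "(-1) ^ Suc m * (\<xi> w * ((-1) ^ Suc m * alt_prod (Suc m) (dbar_word w z) h))
        = \<xi> w * alt_prod (Suc m) (dbar_word w z) h" for w
      by (subst mult.left_commute) (simp only: left_minus_one_mult_self)
  qed
  finally show ?thesis .
qed

theorem theorem6p2:
  fixes m :: nat and \<xi> :: "('n::finite \<times> 'n) list \<Rightarrow> complex"
  assumes "\<xi> \<in> Omega_uni m"
  shows "phi m \<xi> \<in> Omega_CP m \<and>
         d_uni m \<xi> \<in> Omega_uni (Suc m) \<and>
         (\<forall>z h. z \<noteq> 0 \<longrightarrow>
           dbar 0 m (type_proj 0 m (phi m \<xi>)) z h
           = type_proj 0 (Suc m) (phi (Suc m) (d_uni m \<xi>)) z h)"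
proof (intro conjI allI impI)
  show "phi m \<xi> \<in> Omega_CP m" by (rule phi_in_Omega_CP)
  show "d_uni m \<xi> \<in> Omega_uni (Suc m)" using assms by (rule d_uni_in_Omega_uni)
  show "dbar 0 m (type_proj 0 m (phi m \<xi>)) z h
      = type_proj 0 (Suc m) (phi (Suc m) (d_uni m \<xi>)) z h" if "z \<noteq> 0" for z h
    unfolding dbar_type_proj_phi[OF assms that] type_proj_phi_d_uni[OF assms that] ..
qed

end
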